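(* Let $n\ge2$, $R=k[x_1,\ldots,x_n,x_{n+1}]$, and let $I=(x_1f,\ldots,x_nf,g)\subset R$ denote the base ideal of a generalized de Jonquières map $\mathfrak{J}=(x_1f:\cdots:x_nf:g)$ of degree $d\ge2$ with identity support. Let $\mathcal{I}\subset R[y_1,\ldots,y_{n+1}]$ be the presentation ideal of the Rees algebra $\mathcal{R}_R(I)$ of $I$ obtained by mapping $y_i\mapsto x_if$ for $1\le i\le n$ and $y_{n+1}\mapsto g$. Then $$\{p_{i,j}\ (1\le i<j\le n),\ F_0,F_1,\ldots,F_{d-2}\}$$ is a minimal set of generators of $\mathcal{I}$, where $p_{i,j}=x_jy_i-x_iy_j$ and $\{F_0,\ldots,F_{d-2}\}$ is a fully downgraded sequence associated to $\mathfrak{J}$.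
   Context: $k$ is an infinite field. A polynomial is an $x_{n+1}$-monoid if its degree in $x_{n+1}$ is at most $1$. A generalized de Jonquières map of degree $d\ge2$ with identity support is a Cremona transformation $\mathfrak{J}=(x_1f:\cdots:x_nf:g)$ of $\mathbb{P}^n_k$, where $f,g\in R$ are forms of degrees $d-1$ and $d$ with $\gcd(f,g)=1$, both $x_{n+1}$-monoids, at least one of which involves $x_{n+1}$ effectively (then $g\in(x_1,\ldots,x_n)R$). The ideal $\mathcal{I}$ is the kernel of the $R$-algebra homomorphism $R[y_1,\ldots,y_{n+1}]\to\mathcal{R}_R(I)=R[It]\subset R[t]$, $y_i\mapsto x_ift$ $(1\le i\le n)$, $y_{n+1}\mapsto gt$; it is bihomogeneous. Fully downgraded sequence. Write $g=q_1x_1+\cdots+q_nx_n$ with $q_1,\ldots,q_n\in R$ forms of degree $d-1$ that are $x_{n+1}$-monoids (so $f,q_1,\ldots,q_n\in(x_1,\ldots,x_n)^{d-2}R$) and set $F_0:=f\,y_{n+1}-\sum_{i=1}^n q_iy_i\in R[y_1,\ldots,y_{n+1}]$, which is bihomogeneous of bidegree $(d-1,1)$ in (the $x$-variables, the $y$-variables). Inductively, for $0\le i\le d-3$, the form $F_i$ has bidegree $(d-1-i,i+1)$ and lies in $(x_1,\ldots,x_n)^{d-2-i}R[y_1,\ldots,y_{n+1}]$; write $F_i=F_{i,1}x_1+\cdots+F_{i,n}x_n$ with $F_{i,j}$ bihomogeneous of bidegree $(d-2-i,i+1)$ in $(x_1,\ldots,x_n)^{d-3-i}R[y_1,\ldots,y_{n+1}]$,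 and set $F_{i+1}:=F_{i,1}y_1+\cdots+F_{i,n}y_n$. Any $\{F_0,\ldots,F_{d-2}\}$ obtained in this way is a fully downgraded sequence associated to $\mathfrak{J}$. *)

theory Defs
  imports "HOL-Library.Poly_Mapping" "HOL-Computational_Algebra.Polynomial"
begin

section \<open>Multivariate polynomials\<close>

type_synonym ('v, 'a) mpoly = "('v \<Rightarrow>\<^sub>0 nat) \<Rightarrow>\<^sub>0 'a"

text \<open>
  The index type \<open>'n\<close> (finite, linearly ordered) plays the role of \<open>{1, \<dots>, n}\<close>, and
  \<open>'n option\<close> that of \<open>{1, \<dots>, n+1}\<close>, with \<open>None\<close> standing for \<open>n+1\<close>.
  So \<open>('n, 'k) R\<close> is \<open>k[x\<^sub>1,\<dots>,x\<^sub>n\<^sub>+\<^sub>1]\<close>, and \<open>('n, 'k) Ry\<close> is \<open>R[y\<^sub>1,\<dots>,y\<^sub>n\<^sub>+\<^sub>1]\<close>,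
  i.e. polynomials in the \<open>y\<close>'s whose coefficients are polynomials in the \<open>x\<close>'s.
\<close>

type_synonym ('n, 'k) R = "('n option, 'k) mpoly"
type_synonym ('n, 'k) Ry = "('n option, ('n, 'k) R) mpoly"

definition MConst :: "'a::zero \<Rightarrow> ('v, 'a) mpoly" where
  "MConst c = Poly_Mapping.single 0 c"

definition MVar :: "'v \<Rightarrow> ('v, 'a::zero_neq_one) mpoly" where
  "MVar v = Poly_Mapping.single (Poly_Mapping.single v 1) 1"

definition mdeg :: "('v \<Rightarrow>\<^sub>0 nat) \<Rightarrow> nat" where
  "mdeg m = (\<Sum>v\<in>Poly_Mapping.keys m. Poly_Mapping.lookup m v)"

text \<open>As usual, \<open>0\<close> is a form of every degree.\<close>

definition form :: "nat \<Rightarrow> ('v, 'a::zero) mpoly \<Rightarrow> bool" where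
  "form d p \<longleftrightarrow> (\<forall>m\<in>Poly_Mapping.keys p. mdeg m = d)"

definition bihomogeneous :: "nat \<Rightarrow> nat \<Rightarrow> ('w, ('v, 'a::zero) mpoly) mpoly \<Rightarrow> bool" where
  "bihomogeneous a b P \<longleftrightarrow>
     form b P \<and> (\<forall>m\<in>Poly_Mapping.keys P. form a (Poly_Mapping.lookup P m))"

definition eval_hom :: "('a::zero \<Rightarrow> 'b::comm_semiring_1) \<Rightarrow> ('v \<Rightarrow> 'b) \<Rightarrow> ('v, 'a) mpoly \<Rightarrow> 'b" where
  "eval_hom \<phi> h p = (\<Sum>m\<in>Poly_Mapping.keys p. \<phi> (Poly_Mapping.lookup p m) *
       (\<Prod>v\<in>Poly_Mapping.keys m. h v ^ Poly_Mapping.lookup m v))"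

definition subst :: "('v \<Rightarrow> ('w, 'a::comm_semiring_1) mpoly) \<Rightarrow> ('v, 'a) mpoly \<Rightarrow> ('w, 'a) mpoly" where
  "subst h = eval_hom MConst h"

section \<open>Ideals\<close>

definition ideal_gen :: "'a::comm_ring_1 set \<Rightarrow> 'a set" where
  "ideal_gen S = module.span (*) S"

primrec ideal_pow :: "'a::comm_ring_1 set \<Rightarrow> nat \<Rightarrow> 'a set" where
  "ideal_pow I 0 = UNIV"
| "ideal_pow I (Suc m) = ideal_gen {a * b | a b. a \<in> I \<and> b \<in> ideal_pow I m}"

definition minimal_generating_set :: "'a::comm_ring_1 set \<Rightarrow> 'a set \<Rightarrow> bool" where
  "minimal_generating_set I S \<longleftrightarrow> ideal_gen S = I \<and> (\<forall>T. T \<subset> S \<longrightarrow> ideal_gen T \<noteq> I)"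

text \<open>
  The library's \<open>coprime\<close> lives in a class that \<open>mpoly\<close> does not instantiate; this is the same
  formula, i.e. \<open>1\<close> is a greatest common divisor.
\<close>

definition gcd_is_one :: "'a::comm_semiring_1 \<Rightarrow> 'a \<Rightarrow> bool" where
  "gcd_is_one a b \<longleftrightarrow> (\<forall>c. c dvd a \<longrightarrow> c dvd b \<longrightarrow> c dvd 1)"

text \<open>
  For \<open>I = (h v)\<^sub>v\<close>, the kernel of the \<open>R\<close>-algebra homomorphism
  \<open>R[y\<^sub>v] \<rightarrow> R[It] \<subseteq> R[t]\<close>, \<open>y\<^sub>v \<mapsto> h v \<sqdot> t\<close>.  Its image is the Rees algebra \<open>R[It]\<close>.
\<close>

definition rees_presentation_ideal :: "('v \<Rightarrow> 'r::comm_ring_1) \<Rightarrow> ('v, 'r) mpoly set" where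
  "rees_presentation_ideal h =
     {P. eval_hom (\<lambda>c. [:c:]) (\<lambda>v. Polynomial.monom (h v) 1) P = (0 :: 'r poly)}"

section \<open>Cremona transformations\<close>

text \<open>
  A rational map \<open>(G\<^sub>v)\<^sub>v\<close> of projective space is given by forms of the same degree that are not
  all zero; two such tuples give the same map iff they are proportional. A composition is defined
  iff substituting does not make all the forms vanish.
\<close>

definition rational_map :: "nat \<Rightarrow> ('v \<Rightarrow> ('v, 'a::zero) mpoly) \<Rightarrow> bool" where
  "rational_map e G \<longleftrightarrow> (\<forall>v. form e (G v)) \<and> (\<exists>v. G v \<noteq> 0)"

definition same_rational_map ::
    "('v \<Rightarrow> ('v, 'a::comm_semiring_1) mpoly) \<Rightarrow> ('v \<Rightarrow> ('v, 'a) mpoly) \<Rightarrow> bool" where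
  "same_rational_map G H \<longleftrightarrow> (\<forall>u v. G u * H v = G v * H u)"

definition composes_to_identity ::
    "('v \<Rightarrow> ('v, 'a::comm_semiring_1) mpoly) \<Rightarrow> ('v \<Rightarrow> ('v, 'a) mpoly) \<Rightarrow> bool" where
  "composes_to_identity G H \<longleftrightarrow>
     (\<exists>v. subst H (G v) \<noteq> 0) \<and> same_rational_map (\<lambda>v. subst H (G v)) MVar"

definition cremona :: "nat \<Rightarrow> ('v \<Rightarrow> ('v, 'a::comm_semiring_1) mpoly) \<Rightarrow> bool" where
  "cremona d H \<longleftrightarrow> rational_map d H \<and>
     (\<exists>e G. rational_map e G \<and> composes_to_identity G H \<and> composes_to_identity H G)"

section \<open>Generalized de Jonquieres maps with identity support\<close>

definition monoid_poly :: "('n, 'k::zero) R \<Rightarrow> bool" where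
  "monoid_poly p \<longleftrightarrow> (\<forall>m\<in>Poly_Mapping.keys p. Poly_Mapping.lookup m None \<le> 1)"

definition involves_last :: "('n, 'k::zero) R \<Rightarrow> bool" where
  "involves_last p \<longleftrightarrow> (\<exists>m\<in>Poly_Mapping.keys p. Poly_Mapping.lookup m None > 0)"

fun dJ_map :: "('n, 'k::field) R \<Rightarrow> ('n, 'k) R \<Rightarrow> 'n option \<Rightarrow> ('n, 'k) R" where
  "dJ_map f g (Some i) = MVar (Some i) * f"
| "dJ_map f g None = g"

definition gen_de_Jonquieres_id :: "nat \<Rightarrow> ('n, 'k::field) R \<Rightarrow> ('n, 'k) R \<Rightarrow> bool" where
  "gen_de_Jonquieres_id d f g \<longleftrightarrow>
     d \<ge> 2 \<and> cremona d (dJ_map f g) \<and>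
     form (d - 1) f \<and> form d g \<and> gcd_is_one f g \<and>
     monoid_poly f \<and> monoid_poly g \<and> (involves_last f \<or> involves_last g)"

section \<open>Fully downgraded sequences\<close>

definition xvar :: "'n option \<Rightarrow> ('n, 'k::field) Ry" where
  "xvar v = MConst (MVar v)"

definition yvar :: "'n option \<Rightarrow> ('n, 'k::field) Ry" where
  "yvar v = MVar v"

definition p_gen :: "'n \<Rightarrow> 'n \<Rightarrow> ('n, 'k::field) Ry" where
  "p_gen i j = xvar (Some j) * yvar (Some i) - xvar (Some i) * yvar (Some j)"

text \<open>The extension of the ideal \<open>(x\<^sub>1, \<dots>, x\<^sub>n)\<close> to \<open>R[y\<^sub>1, \<dots>, y\<^sub>n\<^sub>+\<^sub>1]\<close>.\<close>

definition mRy :: "('n, 'k::field) Ry set" where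
  "mRy = ideal_gen (range (\<lambda>j. xvar (Some j)))"

definition start_form :: "nat \<Rightarrow> ('n::finite, 'k::field) R \<Rightarrow> ('n, 'k) R \<Rightarrow> ('n, 'k) Ry \<Rightarrow> bool" where
  "start_form d f g F0 \<longleftrightarrow>
     (\<exists>q. (\<forall>i. form (d - 1) (q i) \<and> monoid_poly (q i)) \<and>
          g = (\<Sum>i\<in>UNIV. q i * MVar (Some i)) \<and>
          F0 = MConst f * yvar None - (\<Sum>i\<in>UNIV. MConst (q i) * yvar (Some i)))"

definition downgrades_to :: "nat \<Rightarrow> nat \<Rightarrow> ('n::finite, 'k::field) Ry \<Rightarrow> ('n, 'k) Ry \<Rightarrow> bool" where
  "downgrades_to d i Fi Fi' \<longleftrightarrow>
     (\<exists>c. (\<forall>j. bihomogeneous (d - 2 - i) (i + 1) (c j) \<and> c j \<in> ideal_pow mRy (d - 3 - i)) \<and>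
          Fi = (\<Sum>j\<in>UNIV. c j * xvar (Some j)) \<and>
          Fi' = (\<Sum>j\<in>UNIV. c j * yvar (Some j)))"

text \<open>
  Only \<open>F 0, \<dots>, F (d - 2)\<close> matter. The condition \<open>i + 3 \<le> d\<close> expresses \<open>i \<le> d - 3\<close> without
  truncated subtraction, so that for \<open>d = 2\<close> there is no downgrading step.
\<close>

definition fully_downgraded_sequence ::
    "nat \<Rightarrow> ('n::finite, 'k::field) R \<Rightarrow> ('n, 'k) R \<Rightarrow> (nat \<Rightarrow> ('n, 'k) Ry) \<Rightarrow> bool" where
  "fully_downgraded_sequence d f g F \<longleftrightarrow>
     start_form d f g (F 0) \<and> (\<forall>i. i + 3 \<le> d \<longrightarrow> downgrades_to d i (F i) (F (Suc i)))"

end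

theory Submission
  imports Defs "HOL-Library.Option_ord"
begin

text \<open>
  Let \<open>\<sigma> : R[y\<^sub>1, \<dots>, y\<^sub>n\<^sub>+\<^sub>1] \<rightarrow> R[s, w]\<close> send \<open>y\<^sub>i\<close> to \<open>x\<^sub>i s\<close> and \<open>y\<^sub>n\<^sub>+\<^sub>1\<close> to \<open>w\<close>. Its kernel is generated by the
  \<open>p\<^sub>i\<^sub>j\<close>, its image is spanned by the monomials of weight at least \<open>0\<close> for the grading with
  \<open>x\<^sub>1, \<dots>, x\<^sub>n\<close> of weight \<open>1\<close> and \<open>s\<close> of weight \<open>-1\<close>, and \<open>\<sigma>(F\<^sub>i) = s\<^sup>i \<Phi>\<close> with \<open>\<Phi> = f w - g s\<close>.
  If \<open>P\<close> is a relation, then \<open>\<Phi>\<close> divides \<open>\<sigma>(P)\<close>, because \<open>f\<close> and \<open>g\<close> are coprime in a factorial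
  ring. As one of \<open>f\<close>, \<open>g\<close> involves \<open>x\<^sub>n\<^sub>+\<^sub>1\<close>, the lowest component of \<open>\<Phi>\<close> has weight at most
  \<open>d - 2\<close>, so the cofactor has weights at least \<open>-(d - 2)\<close>; it is therefore a combination of
  \<open>1, s, \<dots>, s\<^sup>d\<^sup>-\<^sup>2\<close> with coefficients in the image of \<open>\<sigma>\<close>, and \<open>P\<close> is congruent to a combination of
  the \<open>F\<^sub>i\<close> modulo the \<open>p\<^sub>i\<^sub>j\<close>.
\<close>

section \<open>Evaluation homomorphisms\<close>

text \<open>Reducing a relation Q of degree e modulo \<open>\<Phi>\<close> only shows that
  \<open>\<Phi>\<close> divides \<open>f\<^sup>e \<sigma>(Q)\<close>. Removing the power of f is the
  main obstacle, and the reason why unique factorization is developed. The number of forms comes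
  from counting unmatched s. A monomial with more s than factors
  \<open>x\<^sub>1, \<dots>, x\<^sub>n\<close> lies outside the image of \<open>\<sigma>\<close>,
  and weight at least \<open>-(d - 2)\<close> allows a surplus of at most \<open>d - 2\<close>. A
  surplus of i is what \<open>F\<^sub>i\<close> carries. The same map gives irredundancy. It kills
  the \<open>p\<^sub>i\<^sub>j\<close>, so a dependence among the generators turns, after division
  by \<open>\<Phi>\<close>, into a linear relation between the powers of s over the image of
  \<open>\<sigma>\<close>. No power of s is such a combination of the others, which settles the
  \<open>F\<^sub>i\<close>; for the \<open>p\<^sub>i\<^sub>j\<close> the relation shows that the
  coefficient of \<open>F\<^sub>0\<close> has no constant term.\<close>

locale comm_ring_hom =
  fixes \<phi> :: "'a::comm_ring_1 \<Rightarrow> 'b::comm_ring_1"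
  assumes hom_add: "\<phi> (a + b) = \<phi> a + \<phi> b"
    and hom_mult: "\<phi> (a * b) = \<phi> a * \<phi> b"
    and hom_one: "\<phi> 1 = 1"
begin

lemma hom_zero: "\<phi> 0 = 0"
  using hom_add[of 0 0] by simp

lemma hom_uminus: "\<phi> (- a) = - \<phi> a"
  using hom_add[of a "- a"] by (simp add: hom_zero eq_neg_iff_add_eq_0 add.commute)

lemma hom_diff: "\<phi> (a - b) = \<phi> a - \<phi> b"
  using hom_add[of a "- b"] by (simp add: hom_uminus)

lemma hom_sum: "\<phi> (sum h A) = (\<Sum>x\<in>A. \<phi> (h x))"
  by (induction A rule: infinite_finite_induct) (simp_all add: hom_zero hom_add)

lemma hom_power: "\<phi> (a ^ n) = \<phi> a ^ n"
  by (induction n) (simp_all add: hom_one hom_mult)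

lemma hom_prod: "\<phi> (prod h A) = (\<Prod>x\<in>A. \<phi> (h x))"
  by (induction A rule: infinite_finite_induct) (simp_all add: hom_one hom_mult)

lemma hom_dvd: "a dvd b \<Longrightarrow> \<phi> a dvd \<phi> b"
  by (elim dvdE) (simp add: hom_mult)

lemmas hom_simps = hom_zero hom_one hom_add hom_mult hom_uminus hom_diff hom_sum hom_power hom_prod

end

lemma comm_ring_hom_id: "comm_ring_hom (\<lambda>x. x)"
  by unfold_locales simp_all

lemma comm_ring_hom_compose:
  assumes "comm_ring_hom \<phi>" "comm_ring_hom \<psi>"
  shows "comm_ring_hom (\<lambda>x. \<psi> (\<phi> x))"
proof -
  interpret f: comm_ring_hom \<phi> by fact
  interpret g: comm_ring_hom \<psi> by fact
  show ?thesis by unfold_locales (simp_all add: f.hom_simps g.hom_simps)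
qed

lemma comm_ring_hom_MConst: "comm_ring_hom (MConst :: 'a::comm_ring_1 \<Rightarrow> ('v, 'a) mpoly)"
  by unfold_locales (simp_all add: MConst_def single_add mult_single)

lemma comm_ring_hom_const_poly: "comm_ring_hom (\<lambda>c::'a::comm_ring_1. [:c:])"
  by unfold_locales (simp_all add: one_pCons)

lemma comm_ring_hom_poly: "comm_ring_hom (\<lambda>p. poly p (a::'a::comm_ring_1))"
  by unfold_locales simp_all

text \<open>The three sums range over different supports; because \<open>G m 0 = 0\<close> each
  extends to the union of the supports, where additivity is termwise. Serves \<open>eval_hom\<close>
  as well as the linear lifting in \<open>sigma_kernel\<close>.\<close>

lemma sum_keys_add:
  fixes G :: "'m \<Rightarrow> 'a::comm_monoid_add \<Rightarrow> 'b::comm_monoid_add"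
  assumes zero: "\<And>m. G m 0 = 0" and add: "\<And>m a b. G m (a + b) = G m a + G m b"
  shows "(\<Sum>m\<in>Poly_Mapping.keys (p + q). G m (Poly_Mapping.lookup (p + q) m)) =
    (\<Sum>m\<in>Poly_Mapping.keys p. G m (Poly_Mapping.lookup p m)) +
    (\<Sum>m\<in>Poly_Mapping.keys q. G m (Poly_Mapping.lookup q m))"
proof -
  let ?K = "Poly_Mapping.keys p \<union> Poly_Mapping.keys q"
  have ext: "(\<Sum>m\<in>Poly_Mapping.keys r. G m (Poly_Mapping.lookup r m)) =
      (\<Sum>m\<in>?K. G m (Poly_Mapping.lookup r m))"
    if "Poly_Mapping.keys r \<subseteq> ?K" for r
    by (rule sum.mono_neutral_left) (use that zero in \<open>auto simp: in_keys_iff\<close>)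
  have "(\<Sum>m\<in>?K. G m (Poly_Mapping.lookup (p + q) m)) =
      (\<Sum>m\<in>?K. G m (Poly_Mapping.lookup p m)) + (\<Sum>m\<in>?K. G m (Poly_Mapping.lookup q m))"
    by (simp add: lookup_add add sum.distrib)
  then show ?thesis
    using ext[of "p + q"] ext[of p] ext[of q] keys_add[of p q] by auto
qed

lemma poly_mapping_eq_sum:
  "p = (\<Sum>m\<in>Poly_Mapping.keys p. Poly_Mapping.single m (Poly_Mapping.lookup p m))"
  by (rule poly_mapping_eqI)
    (auto simp: lookup_sum lookup_single when_def in_keys_iff if_distrib sum.delta cong: if_cong)

lemma poly_mapping_additive_induct [case_names zero single add]:
  fixes p :: "'m \<Rightarrow>\<^sub>0 'a::comm_monoid_add"
  assumes "P 0" "\<And>m c. P (Poly_Mapping.single m c)" "\<And>p q. P p \<Longrightarrow> P q \<Longrightarrow> P (p + q)"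
  shows "P p"
proof -
  have "P (\<Sum>m\<in>A. Poly_Mapping.single m (Poly_Mapping.lookup p m))" for A
    by (induction A rule: infinite_finite_induct) (simp_all add: assms)
  then show ?thesis by (subst poly_mapping_eq_sum)
qed

definition meval :: "('v \<Rightarrow> 'b::comm_semiring_1) \<Rightarrow> ('v \<Rightarrow>\<^sub>0 nat) \<Rightarrow> 'b" where
  "meval h m = (\<Prod>v\<in>Poly_Mapping.keys m. h v ^ Poly_Mapping.lookup m v)"

lemma eval_hom_meval:
  "eval_hom \<phi> h p = (\<Sum>m\<in>Poly_Mapping.keys p. \<phi> (Poly_Mapping.lookup p m) * meval h m)"
  by (simp add: eval_hom_def meval_def)

lemma meval_superset:
  assumes "finite K" "Poly_Mapping.keys m \<subseteq> K"
  shows "meval h m = (\<Prod>v\<in>K. h v ^ Poly_Mapping.lookup m v)"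
  unfolding meval_def by (rule prod.mono_neutral_left) (use assms in \<open>auto simp: in_keys_iff\<close>)

lemma meval_UNIV: "meval h (m :: 'v::finite \<Rightarrow>\<^sub>0 nat) = (\<Prod>v\<in>UNIV. h v ^ Poly_Mapping.lookup m v)"
  by (rule meval_superset) auto

lemma meval_zero [simp]: "meval h 0 = 1"
  by (simp add: meval_def)

lemma meval_single [simp]: "meval h (Poly_Mapping.single v k) = h v ^ k"
  by (simp add: meval_def)

lemma meval_add: "meval h (m + n) = meval h m * meval h n"
proof -
  let ?K = "Poly_Mapping.keys m \<union> Poly_Mapping.keys n"
  have "meval h (m + n) = (\<Prod>v\<in>?K. h v ^ Poly_Mapping.lookup (m + n) v)"
    using keys_add[of m n] by (intro meval_superset) auto
  also have "\<dots> = (\<Prod>v\<in>?K. h v ^ Poly_Mapping.lookup m v) * (\<Prod>v\<in>?K. h v ^ Poly_Mapping.lookup n v)"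
    by (simp add: lookup_add power_add prod.distrib)
  also have "\<dots> = meval h m * meval h n"
    using meval_superset[of ?K m h] meval_superset[of ?K n h] by simp
  finally show ?thesis .
qed

lemma meval_scale: "meval (\<lambda>v. b * h v) m = b ^ mdeg m * meval h m"
  by (simp add: meval_def mdeg_def power_mult_distrib prod.distrib power_sum)

lemma MVar_power: "MVar v ^ k = Poly_Mapping.single (Poly_Mapping.single v k) (1::'a::comm_semiring_1)"
proof (induction k)
  case (Suc k)
  have "Poly_Mapping.single v 1 + Poly_Mapping.single v k = Poly_Mapping.single v (Suc k)"
    by (simp flip: single_add)
  then show ?case using Suc by (simp add: MVar_def mult_single)
qed simp

lemma meval_MVar: "meval MVar m = Poly_Mapping.single m (1::'a::comm_semiring_1)"
proof (induction m rule: poly_mapping_additive_induct)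
  case zero then show ?case by simp
next
  case (single m c) then show ?case by (simp add: MVar_power)
next
  case (add p q) then show ?case by (simp add: meval_add mult_single)
qed

lemma single_eq_MConst_mult:
  "Poly_Mapping.single m c = MConst c * meval MVar (m :: 'v \<Rightarrow>\<^sub>0 nat)" for c :: "'a::comm_semiring_1"
  by (simp add: meval_MVar MConst_def mult_single)

lemma mpoly_induct [case_names const var add mult]:
  fixes p :: "('v, 'a::comm_ring_1) mpoly"
  assumes const: "\<And>c. P (MConst c)" and var: "\<And>v. P (MVar v)"
    and add: "\<And>p q. P p \<Longrightarrow> P q \<Longrightarrow> P (p + q)" and mult: "\<And>p q. P p \<Longrightarrow> P q \<Longrightarrow> P (p * q)"
  shows "P p"
proof (induction p rule: poly_mapping_additive_induct)
  case zero
  then show ?case using const[of 0] by (simp add: MConst_def)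
next
  case (single m c)
  have one: "P 1" using const[of 1] by (simp add: MConst_def)
  have pow: "P (MVar v ^ k)" for v k
    by (induction k) (simp_all add: one var mult)
  have "P (meval MVar m)"
  proof (induction m rule: poly_mapping_additive_induct)
    case zero then show ?case by (simp add: one)
  next
    case (single v k) then show ?case by (simp add: pow)
  next
    case (add m n) then show ?case by (simp add: meval_add mult)
  qed
  then show ?case by (simp add: single_eq_MConst_mult const mult)
next
  case (add p q)
  then show ?case by (rule assms(3))
qed

lemma eval_hom_single: "\<phi> 0 = 0 \<Longrightarrow> eval_hom \<phi> h (Poly_Mapping.single m c) = \<phi> c * meval h m"
  by (cases "c = 0") (simp_all add: eval_hom_meval)

context comm_ring_hom
begin

lemma eval_hom_add: "eval_hom \<phi> h (p + q) = eval_hom \<phi> h p + eval_hom \<phi> h q"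
  unfolding eval_hom_meval
  by (rule sum_keys_add[of "\<lambda>m c. \<phi> c * meval h m"]) (simp_all add: hom_simps distrib_right)

lemma eval_hom_monomial: "eval_hom \<phi> h (Poly_Mapping.single m c) = \<phi> c * meval h m"
  by (simp add: eval_hom_single hom_zero)

lemma eval_hom_mult: "eval_hom \<phi> h (p * q) = eval_hom \<phi> h p * eval_hom \<phi> h q"
proof (induction p rule: poly_mapping_additive_induct)
  case zero then show ?case by (simp add: eval_hom_def)
next
  case (single m c)
  show ?case
  proof (induction q rule: poly_mapping_additive_induct)
    case zero then show ?case by (simp add: eval_hom_def)
  next
    case (single n d)
    then show ?case
      by (simp add: mult_single eval_hom_monomial hom_simps meval_add mult_ac)
  next
    case (add p q) then show ?case by (simp add: distrib_left eval_hom_add)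
  qed
next
  case (add p q) then show ?case by (simp add: distrib_right eval_hom_add)
qed

lemma eval_hom_MConst: "eval_hom \<phi> h (MConst c) = \<phi> c"
  by (simp add: MConst_def eval_hom_monomial)

lemma eval_hom_MVar: "eval_hom \<phi> h (MVar v) = h v"
  by (simp add: MVar_def eval_hom_monomial hom_one)

lemma comm_ring_hom_eval_hom: "comm_ring_hom (eval_hom \<phi> h)"
proof
  show "eval_hom \<phi> h 1 = 1"
    using eval_hom_MConst[of h 1] by (simp add: MConst_def hom_one)
qed (simp_all add: eval_hom_add eval_hom_mult)

end

lemma hom_eqI:
  fixes p :: "('v, 'a::comm_ring_1) mpoly"
  assumes "comm_ring_hom \<phi>" "comm_ring_hom \<psi>"
    and "\<And>c. \<phi> (MConst c) = \<psi> (MConst c)" "\<And>v. \<phi> (MVar v) = \<psi> (MVar v)"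
  shows "\<phi> p = \<psi> p"
proof -
  interpret f: comm_ring_hom \<phi> by fact
  interpret g: comm_ring_hom \<psi> by fact
  show ?thesis
    by (induction p rule: mpoly_induct) (simp_all add: assms f.hom_simps g.hom_simps)
qed

text \<open>Every monomial of a form contributes the same power of \<open>b\<close>. Applied with f,
  with s, with 0, and with the variables a and b of the specialization
  \<open>ab_spec\<close>.\<close>

lemma eval_hom_scale:
  assumes "form e p"
  shows "eval_hom \<phi> (\<lambda>v. b * h v) p = b ^ e * eval_hom \<phi> h p"
  using assms
  by (auto simp: eval_hom_meval meval_scale form_def sum_distrib_left mult_ac intro!: sum.cong)

text \<open>The proof compares the components of least weight of both factors.\<close>

lemma weight_cofactor_ge:
  fixes p q :: "'m::{ordered_cancel_comm_monoid_add, linorder} \<Rightarrow>\<^sub>0 'a::idom"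
    and wt :: "'m \<Rightarrow> int"
  assumes wt_add: "\<And>m n. wt (m + n) = wt m + wt n"
    and m0: "m0 \<in> Poly_Mapping.keys p"
    and pq: "\<And>m. m \<in> Poly_Mapping.keys (p * q) \<Longrightarrow> b \<le> wt m"
    and n: "n \<in> Poly_Mapping.keys q"
  shows "b - wt m0 \<le> wt n"
proof -
  \<comment> \<open>\<open>Min\<close> of an empty set is unspecified, but wherever the value of
    \<open>lo r\<close> matters the support of \<open>r\<close> contains some
    \<open>m\<close>.\<close>
  define lo where "lo r = Min (wt ` Poly_Mapping.keys r)" for r :: "'m \<Rightarrow>\<^sub>0 'a"
  have lo_le: "lo r \<le> wt m" if "m \<in> Poly_Mapping.keys r" for r m
    unfolding lo_def using that by (intro Min_le) auto
  define part where "part r = (\<Sum>m\<in>{m\<in>Poly_Mapping.keys r. wt m = lo r}.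
    Poly_Mapping.single m (Poly_Mapping.lookup r m))" for r :: "'m \<Rightarrow>\<^sub>0 'a"
  have lookup_part: "Poly_Mapping.lookup (part r) m = (if wt m = lo r then Poly_Mapping.lookup r m else 0)" for r m
    unfolding part_def
    by (auto simp: lookup_sum lookup_single when_def in_keys_iff if_distrib sum.delta cong: if_cong)
  have keys_part: "Poly_Mapping.keys (part r) = {m\<in>Poly_Mapping.keys r. wt m = lo r}" for r
    by (auto simp: in_keys_iff lookup_part split: if_splits)
  have keys_rest: "lo r < wt m" if "m \<in> Poly_Mapping.keys (r - part r)" for r m
    using that lo_le[of m r] by (auto simp: in_keys_iff lookup_minus lookup_part split: if_splits)
  have part_nz: "part r \<noteq> 0" if "m \<in> Poly_Mapping.keys r" for r m
  proof -
    have "lo r \<in> wt ` Poly_Mapping.keys r"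
      unfolding lo_def using that by (intro Min_in) auto
    then have "Poly_Mapping.keys (part r) \<noteq> {}" by (auto simp: keys_part)
    then show ?thesis by auto
  qed
  \<comment> \<open>The linear order on the exponents makes the polynomial ring a domain, so the two
    components of least weight have a nonzero product. All other contributions to the product of
    \<open>p\<close> and \<open>q\<close> have larger weight and cannot cancel it.\<close>
  have "part p * part q \<noteq> 0"
    using part_nz m0 n by auto
  then obtain m where m: "m \<in> Poly_Mapping.keys (part p * part q)"
    using poly_mapping_eq_sum[of "part p * part q"] by (metis equals0I sum.empty)
  then obtain a c where "a \<in> Poly_Mapping.keys (part p)" "c \<in> Poly_Mapping.keys (part q)" "m = a + c"
    using keys_mult[of "part p" "part q"] by blast
  then have wt_m: "wt m = lo p + lo q" by (auto simp: keys_part wt_add)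
  have "p * q = part p * part q + ((p - part p) * q + part p * (q - part q))"
    by (simp add: algebra_simps)
  moreover have "m \<notin> Poly_Mapping.keys ((p - part p) * q)"
  proof
    assume "m \<in> Poly_Mapping.keys ((p - part p) * q)"
    then obtain a c where "a \<in> Poly_Mapping.keys (p - part p)" "c \<in> Poly_Mapping.keys q" "m = a + c"
      using keys_mult[of "p - part p" q] by blast
    then show False using wt_m keys_rest[of a p] lo_le[of c q] by (simp add: wt_add)
  qed
  moreover have "m \<notin> Poly_Mapping.keys (part p * (q - part q))"
  proof
    assume "m \<in> Poly_Mapping.keys (part p * (q - part q))"
    then obtain a c where "a \<in> Poly_Mapping.keys (part p)" "c \<in> Poly_Mapping.keys (q - part q)" "m = a + c"
      using keys_mult[of "part p" "q - part q"] by blast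
    then show False using wt_m keys_rest[of c q] by (simp add: wt_add keys_part)
  qed
  ultimately have "m \<in> Poly_Mapping.keys (p * q)"
    using m by (simp add: in_keys_iff lookup_add)
  then have "b \<le> lo p + lo q" using pq[of m] wt_m by simp
  then show ?thesis using lo_le[OF m0] lo_le[OF n] by linarith
qed

section \<open>Unique factorization in polynomial rings\<close>

text \<open>Factoriality is proved by adjoining one variable at a time. The intermediate rings are
  not types of their own, so they are represented as subrings of one fixed domain, and divisibility,
  units and primes are taken relative to the subring.\<close>

locale subring_set =
  fixes A :: "'a::idom set"
  assumes one_closed: "1 \<in> A"
    and diff_closed: "a \<in> A \<Longrightarrow> b \<in> A \<Longrightarrow> a - b \<in> A"
    and mult_closed: "a \<in> A \<Longrightarrow> b \<in> A \<Longrightarrow> a * b \<in> A"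
begin

lemma zero_closed: "0 \<in> A"
  using diff_closed[OF one_closed one_closed] by simp

lemma uminus_closed: "a \<in> A \<Longrightarrow> - a \<in> A"
  using diff_closed[OF zero_closed] by simp

lemma add_closed: "a \<in> A \<Longrightarrow> b \<in> A \<Longrightarrow> a + b \<in> A"
  using diff_closed[of a "- b"] uminus_closed by simp

lemma sum_closed: "(\<And>i. i \<in> I \<Longrightarrow> h i \<in> A) \<Longrightarrow> sum h I \<in> A"
  by (induction I rule: infinite_finite_induct) (simp_all add: zero_closed add_closed)

end

definition dvd_in :: "'a::idom set \<Rightarrow> 'a \<Rightarrow> 'a \<Rightarrow> bool" where
  "dvd_in A a b \<longleftrightarrow> (\<exists>c\<in>A. b = a * c)"

definition prime_in :: "'a::idom set \<Rightarrow> 'a \<Rightarrow> bool" where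
  "prime_in A p \<longleftrightarrow> p \<in> A \<and> p \<noteq> 0 \<and> \<not> dvd_in A p 1 \<and>
     (\<forall>a\<in>A. \<forall>b\<in>A. dvd_in A p (a * b) \<longrightarrow> dvd_in A p a \<or> dvd_in A p b)"

text \<open>The index counts the prime factors; splitting off a prime lowers it by one, which makes
  the extraction of contents terminate.\<close>

inductive prime_product :: "'a::idom set \<Rightarrow> nat \<Rightarrow> 'a \<Rightarrow> bool" for A where
  unit: "u \<in> A \<Longrightarrow> dvd_in A u 1 \<Longrightarrow> prime_product A 0 u"
| prime: "prime_in A p \<Longrightarrow> prime_product A n a \<Longrightarrow> prime_product A (Suc n) (p * a)"

text \<open>Factorizations into primes, and not merely irreducibles, are demanded; their uniqueness
  is then automatic.\<close>

definition factorial_set :: "'a::idom set \<Rightarrow> bool" where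
  "factorial_set A \<longleftrightarrow> (\<forall>a\<in>A. a \<noteq> 0 \<longrightarrow> (\<exists>n. prime_product A n a))"

definition polys_over :: "'a::idom set \<Rightarrow> 'a poly set" where
  "polys_over A = {p. \<forall>i. coeff p i \<in> A}"

context subring_set
begin

lemma dvd_in_diff: "dvd_in A c a \<Longrightarrow> dvd_in A c b \<Longrightarrow> dvd_in A c (a - b)"
  unfolding dvd_in_def by (metis diff_closed right_diff_distrib)

lemma dvd_in_mult: "dvd_in A c a \<Longrightarrow> b \<in> A \<Longrightarrow> dvd_in A c (a * b)"
  unfolding dvd_in_def by (metis mult_closed mult.assoc)

lemma unit_mult:
  assumes "u \<in> A" "dvd_in A u 1" "v \<in> A" "dvd_in A v 1"
  shows "dvd_in A (u * v) 1"
proof -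
  obtain a b where "a \<in> A" "1 = u * a" "b \<in> A" "1 = v * b"
    using assms by (auto simp: dvd_in_def)
  then have "a * b \<in> A" "1 = (u * v) * (a * b)"
    by (auto simp: mult_closed algebra_simps)
  then show ?thesis unfolding dvd_in_def by blast
qed

lemma prime_product_closed: "prime_product A n a \<Longrightarrow> a \<in> A \<and> a \<noteq> 0"
proof (induction rule: prime_product.induct)
  case (unit u) then show ?case by (auto simp: dvd_in_def)
next
  case (prime p n a) then show ?case by (auto simp: prime_in_def mult_closed)
qed

lemma prime_product_unit_mult:
  assumes "prime_product A n a" "u \<in> A" "dvd_in A u 1"
  shows "prime_product A n (u * a)"
  using assms
proof (induction rule: prime_product.induct)
  case (unit v)
  then show ?case by (intro prime_product.unit mult_closed unit_mult)
next
  case (prime p n a)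
  then have "prime_product A (Suc n) (p * (u * a))" by (intro prime_product.prime) auto
  then show ?case by (simp add: mult.left_commute)
qed

lemma prime_product_mult:
  assumes "prime_product A m a" "prime_product A n b"
  shows "prime_product A (m + n) (a * b)"
  using assms
proof (induction rule: prime_product.induct)
  case (unit u) then show ?case by (simp add: prime_product_unit_mult)
next
  case (prime p m a) then show ?case by (simp add: prime_product.prime mult.assoc)
qed

text \<open>If p divides the first prime q, then q divides p as well, since otherwise p would be a
  unit; the two differ by a unit, which the remaining product absorbs. Otherwise p divides the
  remaining product, and induction applies.\<close>

lemma prime_product_cancel:
  assumes "prime_product A n a" "prime_in A p" "b \<in> A" "a = p * b"
  shows "\<exists>m. n = Suc m \<and> prime_product A m b"
  using assms
proof (induction arbitrary: b rule: prime_product.induct)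
  case (unit u)
  then obtain c where "c \<in> A" "1 = p * (b * c)" by (auto simp: dvd_in_def mult.assoc)
  with unit show ?case by (metis prime_in_def dvd_in_def mult_closed)
next
  case (prime q n a)
  have a: "a \<in> A" using prime.hyps prime_product_closed by blast
  have p: "p \<in> A" "p \<noteq> 0" and q: "q \<in> A" "q \<noteq> 0" using prime by (auto simp: prime_in_def)
  have "dvd_in A p (q * a)" using prime by (auto simp: dvd_in_def)
  then consider "dvd_in A p q" | "dvd_in A p a"
    using prime.prems q(1) a unfolding prime_in_def by blast
  then show ?case
  proof cases
    case 1
    then obtain c where c: "c \<in> A" "q = p * c" by (auto simp: dvd_in_def)
    have "dvd_in A q (p * c)" using c one_closed by (force simp: dvd_in_def)
    then have "dvd_in A q p \<or> dvd_in A q c"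
      using prime.hyps(1) p c(1) unfolding prime_in_def by blast
    moreover have "\<not> dvd_in A q c"
    proof
      assume "dvd_in A q c"
      then obtain d where d: "d \<in> A" "c = q * d" by (auto simp: dvd_in_def)
      then have "q * 1 = q * (p * d)" using c(2) by (metis mult.left_commute mult.right_neutral)
      then have "1 = p * d" using q(2) by (rule mult_left_cancel[THEN iffD1, rotated])
      then show False using d prime.prems(1) by (auto simp: prime_in_def dvd_in_def)
    qed
    ultimately obtain d where d: "d \<in> A" "p = q * d" by (auto simp: dvd_in_def)
    then have "p * 1 = p * (c * d)" using c(2) by (metis mult.assoc mult.right_neutral)
    then have "1 = c * d" using p(2) by (rule mult_left_cancel[THEN iffD1, rotated])
    then have "dvd_in A c 1" using d by (auto simp: dvd_in_def)
    moreover have "b = c * a"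
    proof -
      have "p * b = p * (c * a)" using prime.prems(3) c by (simp only: mult_ac)
      then show ?thesis using p(2) by (rule mult_left_cancel[THEN iffD1, rotated])
    qed
    ultimately show ?thesis using prime.hyps c(1) prime_product_unit_mult by auto
  next
    case 2
    then obtain c where c: "c \<in> A" "a = p * c" by (auto simp: dvd_in_def)
    then obtain m where m: "n = Suc m" "prime_product A m c" using prime by blast
    have "p * b = p * (q * c)" using prime.prems(3) c by (simp only: mult_ac)
    then have "b = q * c" using p(2) by (rule mult_left_cancel[THEN iffD1, rotated])
    then show ?thesis using m prime.hyps(1) prime_product.prime by auto
  qed
qed

lemma subring_set_polys_over: "subring_set (polys_over A)"
proof
  show "1 \<in> polys_over A" by (auto simp: polys_over_def one_closed zero_closed)
  show "p - q \<in> polys_over A" if "p \<in> polys_over A" "q \<in> polys_over A" for p q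
    using that by (auto simp: polys_over_def diff_closed)
  show "p * q \<in> polys_over A" if "p \<in> polys_over A" "q \<in> polys_over A" for p q
    using that by (auto simp: polys_over_def coeff_mult intro!: sum_closed mult_closed)
qed

end

locale coeff_subring_set = subring_set A + P: subring_set "polys_over A" for A :: "'a::idom set"
begin

lemma const_polys_over [simp]: "[:c:] \<in> polys_over A \<longleftrightarrow> c \<in> A"
  using zero_closed by (auto simp: polys_over_def coeff_pCons split: nat.splits)

lemma pCons_polys_over: "pCons c p \<in> polys_over A \<longleftrightarrow> c \<in> A \<and> p \<in> polys_over A"
  by (auto simp: polys_over_def coeff_pCons split: nat.splits)

lemma monom_polys_over: "c \<in> A \<Longrightarrow> Polynomial.monom c n \<in> polys_over A"
  by (auto simp: polys_over_def zero_closed)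

lemma const_dvd_in_iff:
  assumes "q \<in> polys_over A"
  shows "dvd_in (polys_over A) [:c:] q \<longleftrightarrow> (\<forall>i. dvd_in A c (coeff q i))"
proof
  assume "dvd_in (polys_over A) [:c:] q"
  then show "\<forall>i. dvd_in A c (coeff q i)"
    by (auto simp: dvd_in_def polys_over_def)
next
  assume "\<forall>i. dvd_in A c (coeff q i)"
  then show "dvd_in (polys_over A) [:c:] q"
    using assms
  proof (induction q)
    case 0
    then show ?case using P.zero_closed by (auto simp: dvd_in_def intro!: bexI[of _ 0])
  next
    case (pCons a q)
    have "dvd_in (polys_over A) [:c:] q"
      using pCons.prems(1)[rule_format, of "Suc _"] pCons by (auto simp: pCons_polys_over)
    moreover have "dvd_in A c a" using pCons.prems(1)[rule_format, of 0] by simp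
    ultimately obtain r b where "r \<in> polys_over A" "q = [:c:] * r" "b \<in> A" "a = c * b"
      by (auto simp: dvd_in_def)
    then have "pCons b r \<in> polys_over A" "pCons a q = [:c:] * pCons b r"
      by (auto simp: pCons_polys_over)
    then show ?case unfolding dvd_in_def by blast
  qed
qed

lemma const_dvd_in_pCons:
  assumes "pCons a q \<in> polys_over A"
  shows "dvd_in (polys_over A) [:c:] (pCons a q) \<longleftrightarrow> dvd_in A c a \<and> dvd_in (polys_over A) [:c:] q"
  using assms
  by (auto simp: const_dvd_in_iff pCons_polys_over coeff_pCons split: nat.splits)

text \<open>This says that \<open>(A/p)[X]\<close> is a domain, without quotient rings: p divides
  one of the two constant coefficients, and subtracting the multiple of p which that coefficient
  yields leaves X times a product of polynomials with fewer coefficients in total.\<close>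

lemma const_prime_dvd_mult:
  assumes p: "prime_in A p"
  shows "a \<in> polys_over A \<Longrightarrow> b \<in> polys_over A \<Longrightarrow> dvd_in (polys_over A) [:p:] (a * b) \<Longrightarrow>
    dvd_in (polys_over A) [:p:] a \<or> dvd_in (polys_over A) [:p:] b"
\<comment> \<open>The number of coefficients is used in place of the degree because it also drops
  when a nonzero constant is replaced by 0.\<close>
proof (induction "length (coeffs a) + length (coeffs b)" arbitrary: a b rule: less_induct)
  case less
  let ?P = "polys_over A"
  have zero: "dvd_in ?P [:p:] 0" using P.zero_closed by (auto simp: dvd_in_def intro!: bexI[of _ 0])
  show ?case
  proof (cases "a = 0 \<or> b = 0")
    case True then show ?thesis using zero by auto
  next
    case False
    obtain a0 a' where a: "a = pCons a0 a'" by (rule pCons_cases)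
    obtain b0 b' where b: "b = pCons b0 b'" by (rule pCons_cases)
    have A: "a0 \<in> A" "a' \<in> ?P" "b0 \<in> A" "b' \<in> ?P" using less.prems a b by (auto simp: pCons_polys_over)
    have len: "length (coeffs a') < length (coeffs a)" "length (coeffs b') < length (coeffs b)"
      using False a b by (auto simp: cCons_def)
    have "coeff (a * b) 0 = a0 * b0" using a b by (simp add: coeff_mult)
    then have "dvd_in A p (a0 * b0)"
      using less.prems by (metis P.mult_closed const_dvd_in_iff)
    then consider "dvd_in A p a0" | "dvd_in A p b0"
      using p A unfolding prime_in_def by blast
    then show ?thesis
    proof cases
      case 1
      then have "dvd_in ?P [:p:] ([:a0:] * b)"
        using less.prems A by (intro P.dvd_in_mult) (auto simp: const_dvd_in_pCons P.zero_closed zero)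
      then have "dvd_in ?P [:p:] (a * b - [:a0:] * b)"
        using less.prems P.dvd_in_diff by blast
      moreover have "a * b - [:a0:] * b = pCons 0 (a' * b)" using a by simp
      ultimately have "dvd_in ?P [:p:] (a' * b)"
        using const_dvd_in_pCons[of 0 "a' * b" p] A less.prems
        by (auto simp: pCons_polys_over zero_closed P.mult_closed)
      then have "dvd_in ?P [:p:] a' \<or> dvd_in ?P [:p:] b"
        using less.hyps[of a' b] len A less.prems by auto
      then show ?thesis using 1 a less.prems by (auto simp: const_dvd_in_pCons)
    next
      case 2
      then have "dvd_in ?P [:p:] ([:b0:] * a)"
        using less.prems A by (intro P.dvd_in_mult) (auto simp: const_dvd_in_pCons P.zero_closed zero)
      then have "dvd_in ?P [:p:] (a * b - [:b0:] * a)"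
        using less.prems P.dvd_in_diff by blast
      moreover have "a * b - [:b0:] * a = pCons 0 (a * b')" using b by (simp add: mult.commute)
      ultimately have "dvd_in ?P [:p:] (a * b')"
        using const_dvd_in_pCons[of 0 "a * b'" p] A less.prems
        by (auto simp: pCons_polys_over zero_closed P.mult_closed)
      then have "dvd_in ?P [:p:] a \<or> dvd_in ?P [:p:] b'"
        using less.hyps[of a b'] len A less.prems by auto
      then show ?thesis using 2 b less.prems by (auto simp: const_dvd_in_pCons)
    qed
  qed
qed

lemma const_prime_in:
  assumes "prime_in A p"
  shows "prime_in (polys_over A) [:p:]"
proof -
  have "\<not> dvd_in (polys_over A) [:p:] 1"
    using assms const_dvd_in_iff[OF P.one_closed, of p]
    by (auto simp: prime_in_def dest!: spec[of _ 0])
  then show ?thesis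
    using assms const_prime_dvd_mult by (auto simp: prime_in_def)
qed

lemma const_prime_product: "prime_product A n a \<Longrightarrow> prime_product (polys_over A) n [:a:]"
proof (induction rule: prime_product.induct)
  case (unit u)
  then obtain c where "c \<in> A" "1 = u * c" by (auto simp: dvd_in_def)
  then have "1 = [:u:] * [:c:]" by (metis comm_ring_hom.hom_mult comm_ring_hom_const_poly one_pCons)
  then show ?case using \<open>c \<in> A\<close> unit by (intro prime_product.unit) (auto simp only: dvd_in_def const_polys_over intro!: bexI[of _ "[:c:]"])
next
  case (prime p n a)
  then have "prime_product (polys_over A) (Suc n) ([:p:] * [:a:])"
    by (intro prime_product.prime const_prime_in)
  then show ?case by (simp add: mult.commute)
qed

section \<open>Primitive polynomials and Gauss's lemma\<close>

definition primitive :: "'a poly \<Rightarrow> bool" where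
  "primitive f \<longleftrightarrow> (\<forall>p. prime_in A p \<longrightarrow> \<not> dvd_in (polys_over A) [:p:] f)"

text \<open>Gauss's lemma in cancellation form. Each prime of c stays prime in \<open>A[X]\<close>
  and divides \<open>f s\<close>; as f is primitive, it divides s and cancels on both sides.\<close>

lemma primitive_strip:
  assumes "prime_product A n c" "primitive f" "f \<in> polys_over A"
    and "s \<in> polys_over A" "t \<in> polys_over A" "f * s = [:c:] * t"
  shows "\<exists>s'\<in>polys_over A. f * s' = t"
  using assms
proof (induction arbitrary: s rule: prime_product.induct)
  case (unit u)
  then obtain d where d: "d \<in> A" "1 = u * d" by (auto simp: dvd_in_def)
  have "f * ([:d:] * s) = [:d:] * ([:u:] * t)" using unit by (metis mult.left_commute)
  also have "\<dots> = [:u * d:] * t" by (simp add: mult.commute)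
  finally have "f * ([:d:] * s) = t" using d by (simp flip: one_pCons)
  then show ?case using d unit by (intro bexI[of _ "[:d:] * s"] P.mult_closed) auto
next
  case (prime p n a)
  have a: "a \<in> A" using prime.hyps prime_product_closed by blast
  have p: "prime_in (polys_over A) [:p:]" "p \<noteq> 0" "p \<in> A"
    using prime.hyps const_prime_in by (auto simp: prime_in_def)
  have fs: "f * s = [:p:] * ([:a:] * t)" using prime.prems by (simp add: mult.commute)
  moreover have "[:a:] * t \<in> polys_over A" using a prime.prems by (intro P.mult_closed) auto
  ultimately have "dvd_in (polys_over A) [:p:] (f * s)" unfolding dvd_in_def by blast
  then have "dvd_in (polys_over A) [:p:] s"
    using p prime.prems prime.hyps unfolding prime_in_def primitive_def by blast
  then obtain r where r: "r \<in> polys_over A" "s = [:p:] * r" by (auto simp: dvd_in_def)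
  then have "[:p:] * (f * r) = [:p:] * ([:a:] * t)" using fs by (metis mult.left_commute)
  then have "f * r = [:a:] * t" using p by (metis mult_left_cancel pCons_eq_0_iff)
  then show ?case using prime r by blast
qed

text \<open>Each prime of c divides q or h in \<open>A[X]\<close> and is cancelled there. The primes
  taken from h are collected in \<open>c2\<close>, so that h is known up to a constant
  afterwards.\<close>

lemma const_split:
  assumes "prime_product A n c" "q \<in> polys_over A" "h \<in> polys_over A" "f \<in> polys_over A"
    and "[:c:] * f = q * h"
  shows "\<exists>q1\<in>polys_over A. \<exists>h1\<in>polys_over A. \<exists>c2\<in>A. c2 \<noteq> 0 \<and> h = [:c2:] * h1 \<and> f = q1 * h1
    \<and> degree q1 \<le> degree q"
  using assms
proof (induction arbitrary: q h rule: prime_product.induct)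
  case (unit u)
  then obtain d where d: "d \<in> A" "1 = u * d" by (auto simp: dvd_in_def)
  have "([:d:] * q) * h = [:d:] * ([:u:] * f)" using unit by (metis mult.assoc)
  also have "\<dots> = [:u * d:] * f" by (simp add: mult.commute)
  finally have "f = ([:d:] * q) * h" using d by (simp flip: one_pCons)
  then show ?case using d unit one_closed
    by (intro bexI[of _ "[:d:] * q"] bexI[of _ h] bexI[of _ 1] P.mult_closed)
      (auto simp flip: one_pCons)
next
  case (prime p n a)
  have a: "a \<in> A" using prime.hyps prime_product_closed by blast
  have p: "prime_in (polys_over A) [:p:]" "p \<noteq> 0" "p \<in> A"
    using prime.hyps const_prime_in by (auto simp: prime_in_def)
  have qh: "q * h = [:p:] * ([:a:] * f)" using prime.prems by (simp add: mult.commute)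
  moreover have "[:a:] * f \<in> polys_over A" using a prime.prems by (intro P.mult_closed) auto
  ultimately have "dvd_in (polys_over A) [:p:] (q * h)" unfolding dvd_in_def by blast
  then consider "dvd_in (polys_over A) [:p:] q" | "dvd_in (polys_over A) [:p:] h"
    using p prime.prems unfolding prime_in_def by blast
  then show ?case
  proof cases
    case 1
    then obtain r where r: "r \<in> polys_over A" "q = [:p:] * r" by (auto simp: dvd_in_def)
    then have "[:p:] * ([:a:] * f) = [:p:] * (r * h)" using qh by (metis mult.assoc)
    then have "[:a:] * f = r * h" using p by (metis mult_left_cancel pCons_eq_0_iff)
    moreover have "degree r = degree q" using r p by simp
    ultimately show ?thesis using prime.IH[of r h] r prime.prems by auto
  next
    case 2
    then obtain r where r: "r \<in> polys_over A" "h = [:p:] * r" by (auto simp: dvd_in_def)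
    then have "[:p:] * ([:a:] * f) = [:p:] * (q * r)" using qh by (metis mult.left_commute)
    then have "[:a:] * f = q * r" using p by (metis mult_left_cancel pCons_eq_0_iff)
    then obtain q1 h1 c2 where q1: "q1 \<in> polys_over A" "h1 \<in> polys_over A" "c2 \<in> A" "c2 \<noteq> 0"
      "r = [:c2:] * h1" "f = q1 * h1" "degree q1 \<le> degree q"
      using prime.IH[of q r] r prime.prems by blast
    then have "p * c2 \<in> A" "p * c2 \<noteq> 0" "h = [:p * c2:] * h1"
      using r p by (auto simp: mult_closed mult.commute)
    then show ?thesis using q1 by blast
  qed
qed

text \<open>Replaces Euclidean division over the fraction field: rather than inverting the leading
  coefficient of h, m is multiplied by it before its top term is cancelled, and c collects these
  factors.\<close>

lemma pseudo_division:
  assumes h: "h \<in> polys_over A" "h \<noteq> 0"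
  shows "m \<in> polys_over A \<Longrightarrow> \<exists>c\<in>A. \<exists>q\<in>polys_over A. c \<noteq> 0 \<and>
    ([:c:] * m - q * h = 0 \<or> degree ([:c:] * m - q * h) < degree h)"
proof (induction "length (coeffs m)" arbitrary: m rule: less_induct)
  case less
  show ?case
  proof (cases "m = 0 \<or> degree m < degree h")
    case True
    then have "[:1:] * m - 0 * h = 0 \<or> degree ([:1:] * m - 0 * h) < degree h" by auto
    then show ?thesis using one_closed P.zero_closed zero_neq_one by metis
  next
    case False
    define l where "l = lead_coeff h"
    define s where "s = Polynomial.monom (lead_coeff m) (degree m - degree h)"
    have l: "l \<in> A" "l \<noteq> 0" using h by (auto simp: l_def polys_over_def)
    have s: "s \<in> polys_over A" using less.prems by (auto simp: s_def monom_polys_over polys_over_def zero_closed)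
    define m' where "m' = [:l:] * m - s * h"
    have m'P: "m' \<in> polys_over A"
      unfolding m'_def using l s h less.prems by (intro P.diff_closed P.mult_closed) auto
    have "m \<noteq> 0" "degree h \<le> degree m" using False by auto
    then have "s \<noteq> 0" "degree s = degree m - degree h" and lead_s: "lead_coeff s = lead_coeff m"
      by (simp_all add: s_def degree_monom_eq)
    then have deg_sh: "degree (s * h) = degree m" using h \<open>degree h \<le> degree m\<close>
      by (simp add: degree_mult_eq)
    have "coeff (s * h) (degree m) = coeff (s * h) (degree (s * h))" using deg_sh by simp
    also have "\<dots> = lead_coeff m * l"
      by (simp only: lead_coeff_mult lead_s l_def)
    finally have "coeff m' (degree m) = 0" by (simp add: m'_def)
    moreover have "degree m' \<le> degree m" unfolding m'_def using deg_sh
      by (intro degree_diff_le) auto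
    ultimately have "m' = 0 \<or> degree m' < degree m"
      by (metis eq_zero_or_degree_less)
    then have "length (coeffs m') < length (coeffs m)" using False
      by (cases "m' = 0") (auto simp: length_coeffs_degree)
    then obtain c q where cq: "c \<in> A" "q \<in> polys_over A" "c \<noteq> 0"
      "[:c:] * m' - q * h = 0 \<or> degree ([:c:] * m' - q * h) < degree h"
      using less.hyps m'P by blast
    have eq: "[:c * l:] * m - ([:c:] * s + q) * h = [:c:] * m' - q * h"
    proof -
      have "[:c * l:] = [:c:] * [:l:]" by simp
      then show ?thesis unfolding m'_def by (simp only: algebra_simps)
    qed
    have "c * l \<in> A" "[:c:] * s + q \<in> polys_over A" "c * l \<noteq> 0"
      using cq l s by (auto simp: mult_closed intro!: P.add_closed P.mult_closed simp del: mult_pCons_left)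
    then show ?thesis using cq(4) eq by metis
  qed
qed

text \<open>
  If \<open>f\<close> divides \<open>a * b\<close>, a nonzero element \<open>h\<close> of least degree in the ideal \<open>(f, a)\<close> divides constant
  multiples of \<open>f\<close> and \<open>a\<close>. By irreducibility \<open>h\<close> is then either constant, and \<open>f\<close> divides \<open>b\<close>, or
  associated to \<open>f\<close> up to constants, and \<open>f\<close> divides \<open>a\<close>; primitivity removes the constants.
\<close>

lemma primitive_irreducible_prime:
  assumes A: "factorial_set A"
    and f: "f \<in> polys_over A" "primitive f" "degree f > 0"
    and irr: "\<And>g h. g \<in> polys_over A \<Longrightarrow> h \<in> polys_over A \<Longrightarrow> f = g * h \<Longrightarrow> degree g = 0 \<or> degree h = 0"
  shows "prime_in (polys_over A) f"
proof -
  let ?P = "polys_over A"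
  have f0: "f \<noteq> 0" using f by auto
  have strip: "dvd_in ?P f t" if "c \<in> A" "c \<noteq> 0" "s \<in> ?P" "t \<in> ?P" "f * s = [:c:] * t" for c s t
    using A that f primitive_strip[of _ c f s t] unfolding factorial_set_def dvd_in_def by metis
  have "dvd_in ?P f a \<or> dvd_in ?P f b" if a: "a \<in> ?P" and b: "b \<in> ?P" and ab: "dvd_in ?P f (a * b)" for a b
  proof -
    define M where "M = {u * f + v * a | u v. u \<in> ?P \<and> v \<in> ?P}"
    have MP: "M \<subseteq> ?P" using f a by (auto simp: M_def P.add_closed P.mult_closed)
    have fM: "f \<in> M" using P.one_closed P.zero_closed unfolding M_def by (smt (verit) mem_Collect_eq add_0_right mult_1 mult_zero_left)
    have aM: "a \<in> M" using P.one_closed P.zero_closed unfolding M_def by (smt (verit) mem_Collect_eq add_0 mult_1 mult_zero_left)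
    obtain h where h: "h \<in> M" "h \<noteq> 0" and min: "\<And>k. k \<in> M \<Longrightarrow> k \<noteq> 0 \<Longrightarrow> degree h \<le> degree k"
      using ex_has_least_nat[of "\<lambda>k. k \<in> M \<and> k \<noteq> 0" f degree] fM f0 by blast
    have hP: "h \<in> ?P" using h MP by auto
    have div: "\<exists>c\<in>A. \<exists>q\<in>?P. c \<noteq> 0 \<and> [:c:] * m = q * h" if m: "m \<in> M" for m
    proof -
      obtain c q where cq: "c \<in> A" "q \<in> ?P" "c \<noteq> 0"
        and r: "[:c:] * m - q * h = 0 \<or> degree ([:c:] * m - q * h) < degree h"
        using pseudo_division[OF hP h(2)] m MP by blast
      obtain u v u' v' where uv: "u \<in> ?P" "v \<in> ?P" "u' \<in> ?P" "v' \<in> ?P"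
        and mh: "m = u * f + v * a" "h = u' * f + v' * a"
        using m h by (auto simp: M_def)
      have "[:c:] * m - q * h = ([:c:] * u - q * u') * f + ([:c:] * v - q * v') * a"
        unfolding mh by (simp only: algebra_simps)
      moreover have "[:c:] * u - q * u' \<in> ?P" "[:c:] * v - q * v' \<in> ?P"
        using cq uv by (auto intro!: P.diff_closed P.mult_closed simp del: mult_pCons_left)
      ultimately have "[:c:] * m - q * h \<in> M" unfolding M_def by blast
      then have "[:c:] * m - q * h = 0" using r min by force
      then show ?thesis using cq by auto
    qed
    obtain c q where c: "c \<in> A" "q \<in> ?P" "c \<noteq> 0" "[:c:] * f = q * h" using div[OF fM] by blast
    then obtain n where "prime_product A n c" using A by (auto simp: factorial_set_def)
    then obtain q1 h1 c2 where q1: "q1 \<in> ?P" "h1 \<in> ?P" "c2 \<in> A" "c2 \<noteq> 0" "h = [:c2:] * h1" "f = q1 * h1"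
      using const_split[of n c q h f] c f hP by blast
    from irr[OF q1(1,2,6)] show ?thesis
    proof
      assume "degree h1 = 0"
      then have "degree h = 0" using q1 by simp
      then obtain e where e: "h = [:e:]" by (auto elim: degree_eq_zeroE)
      then have eA: "e \<in> A" "e \<noteq> 0" using hP h by auto
      obtain u v where uv: "u \<in> ?P" "v \<in> ?P" "h = u * f + v * a" using h by (auto simp: M_def)
      obtain w where w: "w \<in> ?P" "a * b = f * w" using ab by (auto simp: dvd_in_def)
      have "[:e:] * b = u * f * b + v * (a * b)" using uv e by (simp add: algebra_simps)
      also have "\<dots> = f * (u * b + v * w)" using w by (simp add: algebra_simps)
      finally have "f * (u * b + v * w) = [:e:] * b" by simp
      then have "dvd_in ?P f b"
        using strip[OF eA _ b] uv w b by (meson P.add_closed P.mult_closed)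
      then show ?thesis by simp
    next
      assume "degree q1 = 0"
      then obtain k where k: "q1 = [:k:]" by (auto elim: degree_eq_zeroE)
      then have kA: "k \<in> A" "k \<noteq> 0" using q1 f0 by auto
      obtain d r where d: "d \<in> A" "r \<in> ?P" "d \<noteq> 0" "[:d:] * a = r * h" using div[OF aM] by blast
      have "[:k * d:] * a = [:k:] * ([:d:] * a)" by (simp add: mult.commute)
      also have "\<dots> = f * (r * [:c2:])" unfolding d(4) q1(5,6) k by (simp only: mult_ac)
      finally have "f * (r * [:c2:]) = [:k * d:] * a" by simp
      moreover have "r * [:c2:] \<in> ?P" using d q1 by (intro P.mult_closed) auto
      ultimately have "dvd_in ?P f a"
        using strip[of "k * d" _ a] kA d a by (meson mult_closed mult_eq_0_iff)
      then show ?thesis by simp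
    qed
  qed
  moreover have "\<not> dvd_in ?P f 1"
  proof
    assume "dvd_in ?P f 1"
    then obtain g where "1 = f * g" by (auto simp: dvd_in_def)
    then have "f dvd 1" by (auto simp: dvd_def)
    then show False using f(3) dvd_imp_degree_le[of f 1] by simp
  qed
  ultimately show ?thesis using f f0 unfolding prime_in_def by blast
qed

text \<open>A prime constant dividing f also divides its leading coefficient, whose number of prime
  factors therefore bounds how often a constant can be split off.\<close>

lemma extract_content:
  assumes "prime_product A n (lead_coeff f)" "f \<in> polys_over A"
  shows "\<exists>m c f'. prime_product A m c \<and> f' \<in> polys_over A \<and> primitive f' \<and> f = [:c:] * f'"
  using assms
proof (induction n arbitrary: f rule: less_induct)
  case (less n)
  show ?case
  proof (cases "primitive f")
    case True
    have "prime_product A 0 1" using one_closed by (intro prime_product.unit) (auto simp: dvd_in_def)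
    then show ?thesis using True less.prems by (intro exI[of _ 0] exI[of _ 1] exI[of _ f]) (simp flip: one_pCons)
  next
    case False
    then obtain p g where p: "prime_in A p" and g: "g \<in> polys_over A" "f = [:p:] * g"
      by (auto simp: primitive_def dvd_in_def)
    have "p \<noteq> 0" using p by (auto simp: prime_in_def)
    then have "lead_coeff f = p * lead_coeff g" using g by simp
    moreover have "lead_coeff g \<in> A" using g by (auto simp: polys_over_def)
    ultimately obtain k where k: "n = Suc k" "prime_product A k (lead_coeff g)"
      using prime_product_cancel[OF less.prems(1) p] by blast
    then obtain m c f' where "prime_product A m c" "f' \<in> polys_over A" "primitive f'" "g = [:c:] * f'"
      using less.IH[of k g] g by auto
    then have "f = [:p * c:] * f'" using g(2) by (simp add: mult.commute)
    moreover have "prime_product A (Suc m) (p * c)"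
      using prime_product.prime[OF p \<open>prime_product A m c\<close>] .
    ultimately show ?thesis using \<open>f' \<in> polys_over A\<close> \<open>primitive f'\<close> by blast
  qed
qed

text \<open>Once the content is removed, a nonconstant \<open>f'\<close> either splits into factors
  of positive, hence smaller, degree, which the induction covers, or is prime by
  \<open>primitive_irreducible_prime\<close>.\<close>

theorem factorial_set_polys_over:
  assumes A: "factorial_set A"
  shows "factorial_set (polys_over A)"
proof -
  let ?P = "polys_over A"
  have "\<exists>n. prime_product ?P n f" if "f \<in> ?P" "f \<noteq> 0" for f
    using that
  proof (induction "degree f" arbitrary: f rule: less_induct)
    case less
    have "lead_coeff f \<in> A" "lead_coeff f \<noteq> 0" using less.prems by (auto simp: polys_over_def)
    then obtain m c f' where c: "prime_product A m c" and f': "f' \<in> ?P" "primitive f'" "f = [:c:] * f'"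
      using A extract_content less.prems unfolding factorial_set_def by metis
    have c': "prime_product ?P m [:c:]" "c \<noteq> 0" using c const_prime_product prime_product_closed by auto
    have f'0: "f' \<noteq> 0" using f' less.prems by auto
    have deg: "degree f = degree f'" using f' c' by simp
    have "\<exists>n. prime_product ?P n f'"
    proof (cases "degree f' = 0")
      case True
      then obtain e where "f' = [:e:]" by (auto elim: degree_eq_zeroE)
      then have "e \<in> A" "e \<noteq> 0" using f'(1) f'0 by auto
      then show ?thesis using A const_prime_product \<open>f' = [:e:]\<close> unfolding factorial_set_def by blast
    next
      case pos: False
      show ?thesis
      proof (cases "\<exists>g\<in>?P. \<exists>h\<in>?P. f' = g * h \<and> degree g > 0 \<and> degree h > 0")
        case True
        then obtain g h where gh: "g \<in> ?P" "h \<in> ?P" "f' = g * h" "degree g > 0" "degree h > 0" by blast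
        have "degree f' = degree g + degree h" using gh f'0 by (auto simp: degree_mult_eq)
        then have "\<exists>n. prime_product ?P n g" "\<exists>n. prime_product ?P n h"
          using less.hyps[of g] less.hyps[of h] gh deg f'0 by auto
        then show ?thesis using gh P.prime_product_mult by blast
      next
        case False
        then have "prime_in ?P f'" using f' pos A by (intro primitive_irreducible_prime) auto
        moreover have "prime_product ?P 0 1" using P.one_closed
          by (intro prime_product.unit) (auto simp: dvd_in_def)
        ultimately have "prime_product ?P (Suc 0) (f' * 1)" by (rule prime_product.prime)
        then show ?thesis by auto
      qed
    qed
    then show ?case using c'(1) f'(3) P.prime_product_mult by blast
  qed
  then show ?thesis by (auto simp: factorial_set_def)
qed

end

section \<open>Adjoining finitely many variables\<close>

inductive_set polys_in :: "'v set \<Rightarrow> ('v, 'a::comm_ring_1) mpoly set" for V where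
  const: "MConst c \<in> polys_in V"
| var: "v \<in> V \<Longrightarrow> MVar v \<in> polys_in V"
| add: "p \<in> polys_in V \<Longrightarrow> q \<in> polys_in V \<Longrightarrow> p + q \<in> polys_in V"
| mult: "p \<in> polys_in V \<Longrightarrow> q \<in> polys_in V \<Longrightarrow> p * q \<in> polys_in V"

lemma polys_in_UNIV: "p \<in> polys_in UNIV"
  by (induction p rule: mpoly_induct) (auto intro: polys_in.intros)

lemma polys_in_mono: "p \<in> polys_in V \<Longrightarrow> V \<subseteq> W \<Longrightarrow> p \<in> polys_in W"
  by (induction rule: polys_in.induct) (auto intro: polys_in.intros)

lemma (in subring_set) coeff_subring_set: "coeff_subring_set A"
  by (intro coeff_subring_set.intro subring_set_axioms subring_set_polys_over)

lemma subring_set_polys_in: "subring_set (polys_in V :: ('v::linorder, 'k::idom) mpoly set)"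
proof -
  interpret C: comm_ring_hom "MConst :: 'k \<Rightarrow> ('v, 'k) mpoly" by (rule comm_ring_hom_MConst)
  have neg: "- p \<in> polys_in V" if "p \<in> polys_in V" for p :: "('v, 'k) mpoly"
    using polys_in.mult[OF polys_in.const[of "-1 :: 'k"] that] by (simp add: C.hom_simps)
  show ?thesis
  proof
    show "(1 :: ('v, 'k) mpoly) \<in> polys_in V" using polys_in.const[of "1::'k" V] by (simp add: C.hom_simps)
    show "p - q \<in> polys_in V" if "p \<in> polys_in V" "q \<in> polys_in V" for p q :: "('v, 'k) mpoly"
      using polys_in.add[OF that(1) neg[OF that(2)]] by simp
  qed (rule polys_in.mult)
qed

lemma factorial_set_image:
  assumes \<phi>: "comm_ring_hom \<phi>" and A: "subring_set A" and fact: "factorial_set A"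
    and inj: "inj_on \<phi> A"
  shows "factorial_set (\<phi> ` A)"
proof -
  interpret h: comm_ring_hom \<phi> by fact
  interpret A: subring_set A by fact
  have dvd: "dvd_in (\<phi> ` A) (\<phi> a) (\<phi> b) \<longleftrightarrow> dvd_in A a b" if "a \<in> A" "b \<in> A" for a b
  proof
    assume "dvd_in (\<phi> ` A) (\<phi> a) (\<phi> b)"
    then obtain c where c: "c \<in> A" "\<phi> b = \<phi> (a * c)" by (auto simp: dvd_in_def h.hom_simps)
    then have "b = a * c" using inj_onD[OF inj c(2)] that A.mult_closed by auto
    then show "dvd_in A a b" using c by (auto simp: dvd_in_def)
  qed (auto simp: dvd_in_def h.hom_simps)
  have prime: "prime_in (\<phi> ` A) (\<phi> p)" if p: "prime_in A p" for p
  proof -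
    have pA: "p \<in> A" "p \<noteq> 0" using p by (auto simp: prime_in_def)
    have "\<phi> p \<noteq> 0" using inj_onD[OF inj, of p 0] pA A.zero_closed h.hom_zero by auto
    moreover have "\<not> dvd_in (\<phi> ` A) (\<phi> p) 1"
      using dvd[of p 1] pA A.one_closed p by (simp add: h.hom_simps prime_in_def)
    moreover have "dvd_in (\<phi> ` A) (\<phi> p) (\<phi> a) \<or> dvd_in (\<phi> ` A) (\<phi> p) (\<phi> b)"
      if "a \<in> A" "b \<in> A" "dvd_in (\<phi> ` A) (\<phi> p) (\<phi> a * \<phi> b)" for a b
      using that dvd pA p by (auto simp: prime_in_def A.mult_closed simp flip: h.hom_mult)
    ultimately show ?thesis using pA unfolding prime_in_def by blast
  qed
  have "prime_product (\<phi> ` A) n (\<phi> a)" if "prime_product A n a" for n a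
    using that
  proof (induction rule: prime_product.induct)
    case (unit u)
    then show ?case using dvd[of u 1] A.one_closed by (intro prime_product.unit) (auto simp: h.hom_simps)
  next
    case (prime p n a)
    then show ?case using \<open>\<And>p. prime_in A p \<Longrightarrow> _\<close> by (simp add: h.hom_simps prime_product.prime)
  qed
  moreover have "a \<noteq> 0" if "\<phi> a \<noteq> 0" for a using that h.hom_zero by auto
  ultimately show ?thesis using fact by (force simp: factorial_set_def)
qed

text \<open>Polynomials in the variables of V and v are univariate polynomials in v over those in V.
  Substituting \<open>MVar v\<close> for the univariate variable is inverse to
  \<open>\<psi>\<close>, which keeps v as the variable and treats all others as constants;
  factoriality is carried along this isomorphism.\<close>

lemma factorial_set_polys_in_insert:
  fixes V :: "'v::linorder set"
  assumes v: "v \<notin> V" and fact: "factorial_set (polys_in V :: ('v, 'k::idom) mpoly set)"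
  shows "factorial_set (polys_in (insert v V) :: ('v, 'k) mpoly set)"
proof -
  let ?A = "polys_in V :: ('v, 'k) mpoly set"
  interpret A: coeff_subring_set ?A
    by (rule subring_set.coeff_subring_set[OF subring_set_polys_in])
  let ?ev = "\<lambda>p. poly p (MVar v :: ('v, 'k) mpoly)"
  interpret ev: comm_ring_hom ?ev by (rule comm_ring_hom_poly)
  let ?c = "\<lambda>c. [:MConst c :: ('v, 'k) mpoly:]"
  let ?h = "\<lambda>u. if u = v then [:0, 1:] else [:MVar u :: ('v, 'k) mpoly:]"
  define \<psi> where "\<psi> = eval_hom ?c ?h"
  have c: "comm_ring_hom ?c"
    by (rule comm_ring_hom_compose[OF comm_ring_hom_MConst comm_ring_hom_const_poly])
  interpret c: comm_ring_hom ?c by (rule c)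
  interpret \<psi>: comm_ring_hom \<psi> unfolding \<psi>_def by (rule c.comm_ring_hom_eval_hom)
  have \<psi>_const: "\<psi> (MConst a) = [:MConst a:]" and \<psi>_var: "\<psi> (MVar u) = ?h u" for a u
    by (simp_all add: \<psi>_def c.eval_hom_MConst c.eval_hom_MVar)
  have ev_\<psi>: "?ev (\<psi> p) = p" for p
    by (induction p rule: mpoly_induct) (simp_all add: \<psi>.hom_simps \<psi>_const \<psi>_var)
  have \<psi>_A: "\<psi> p = [:p:]" if "p \<in> ?A" for p
    using that by (induction rule: polys_in.induct) (use v in \<open>auto simp: \<psi>.hom_simps \<psi>_const \<psi>_var\<close>)
  have \<psi>_in: "\<psi> p \<in> polys_over ?A" if "p \<in> polys_in (insert v V)" for p
    using that
  proof (induction rule: polys_in.induct)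
    case (const c) then show ?case by (simp add: \<psi>_const polys_in.const)
  next
    case (var u)
    then show ?case
      by (auto simp: \<psi>_var polys_in.var A.pCons_polys_over A.zero_closed A.one_closed A.P.zero_closed)
  qed (simp_all add: \<psi>.hom_simps A.P.add_closed A.P.mult_closed)
  have ev_in: "?ev p \<in> polys_in (insert v V) \<and> \<psi> (?ev p) = p" if "p \<in> polys_over ?A" for p
    using that
  proof (induction p)
    case 0 then show ?case
      using polys_in_mono[OF A.zero_closed, of "insert v V"] by (simp add: \<psi>.hom_simps subset_insertI)
  next
    case (pCons a p)
    then have a: "a \<in> ?A" and p: "?ev p \<in> polys_in (insert v V)" "\<psi> (?ev p) = p"
      by (auto simp: A.pCons_polys_over)
    have "a \<in> polys_in (insert v V)" using a by (rule polys_in_mono) blast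
    moreover have "MVar v * ?ev p \<in> polys_in (insert v V)"
      using p(1) by (intro polys_in.mult polys_in.var) auto
    ultimately have "?ev (pCons a p) \<in> polys_in (insert v V)"
      by (simp add: polys_in.add)
    then show ?case by (simp add: \<psi>.hom_simps \<psi>_A[OF a] \<psi>_var p(2))
  qed
  have "inj_on ?ev (polys_over ?A)" using ev_in by (intro inj_on_inverseI[of _ \<psi>]) blast
  moreover have "?ev ` polys_over ?A = polys_in (insert v V)"
  proof (intro equalityI subsetI)
    fix p :: "('v, 'k) mpoly"
    assume "p \<in> polys_in (insert v V)"
    then show "p \<in> ?ev ` polys_over ?A" using \<psi>_in[of p] ev_\<psi>[of p] by (intro image_eqI[of _ _ "\<psi> p"]) simp_all
  qed (use ev_in in blast)
  ultimately show ?thesis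
    using factorial_set_image[OF ev.comm_ring_hom_axioms A.P.subring_set_axioms
        A.factorial_set_polys_over[OF fact]] by simp
qed

lemma factorial_set_mpoly: "factorial_set (UNIV :: ('v::{finite, linorder}, 'k::field) mpoly set)"
proof -
  interpret C: comm_ring_hom "MConst :: 'k \<Rightarrow> ('v, 'k) mpoly" by (rule comm_ring_hom_MConst)
  have "factorial_set (polys_in V :: ('v, 'k) mpoly set)" if "finite V" for V
    using that
  proof (induction V)
    case empty
    have "p \<in> range MConst" if "p \<in> polys_in {}" for p :: "('v, 'k) mpoly"
      using that by (induction rule: polys_in.induct) (auto simp flip: C.hom_add C.hom_mult)
    then have range: "\<exists>c. p = MConst c" if "p \<in> polys_in {}" for p :: "('v, 'k) mpoly"
      using that by blast
    have "prime_product (polys_in {}) 0 (MConst c :: ('v, 'k) mpoly)" if "c \<noteq> 0" for c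
    proof (rule prime_product.unit)
      have "(1 :: ('v, 'k) mpoly) = MConst (c * inverse c)"
        using that C.hom_one by simp
      then have "(1 :: ('v, 'k) mpoly) = MConst c * MConst (inverse c)"
        by (simp only: C.hom_mult)
      then show "dvd_in (polys_in {}) (MConst c :: ('v, 'k) mpoly) 1"
        unfolding dvd_in_def by (rule bexI[OF _ polys_in.const])
    qed (rule polys_in.const)
    then show ?case unfolding factorial_set_def using range C.hom_zero by metis
  next
    case (insert v V)
    then show ?case by (intro factorial_set_polys_in_insert)
  qed
  from this[of UNIV] have "factorial_set (polys_in UNIV :: ('v, 'k) mpoly set)" by simp
  moreover have "polys_in UNIV = (UNIV :: ('v, 'k) mpoly set)" using polys_in_UNIV by blast
  ultimately show ?thesis by simp
qed

text \<open>Euclid's lemma, one prime of f at a time: the prime does not divide g, so it divides a,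
  and it is cancelled from f and a. What remains of f is still coprime to g.\<close>

lemma gcd_is_one_dvd_mult_cancel:
  fixes f :: "('v::{finite, linorder}, 'k::field) mpoly"
  assumes "gcd_is_one f g" "f \<noteq> 0" "f dvd a * g"
  shows "f dvd a"
proof -
  have dvd: "dvd_in UNIV p q \<longleftrightarrow> p dvd q" for p q :: "('v, 'k) mpoly"
    by (simp add: dvd_in_def dvd_def)
  obtain n where "prime_product UNIV n f"
    using factorial_set_mpoly assms(2) unfolding factorial_set_def by blast
  then show ?thesis using assms(1,3)
  proof (induction arbitrary: a rule: prime_product.induct)
    case (unit u)
    then have "u dvd 1" by (simp only: dvd)
    then show ?case by (rule dvd_trans) simp
  next
    case (prime p n f)
    have p: "p \<noteq> 0" "\<not> p dvd 1" "\<And>a b. p dvd a * b \<Longrightarrow> p dvd a \<or> p dvd b"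
      using prime.hyps(1) unfolding prime_in_def dvd by blast+
    have "\<not> p dvd g"
    proof
      assume "p dvd g"
      moreover have "p dvd p * f" by (rule dvd_triv_left)
      ultimately show False using prime.prems(1) p(2) unfolding gcd_is_one_def by blast
    qed
    moreover have "p dvd a * g" using prime.prems(2) by (rule dvd_mult_left)
    ultimately have "p dvd a" using p(3) by blast
    then obtain a' where a': "a = p * a'" by (rule dvdE)
    have "p * f dvd p * (a' * g)" using prime.prems(2) by (simp only: a' mult.assoc)
    then have "f dvd a' * g" using p(1) by (simp only: dvd_mult_cancel_left) simp
    moreover have "gcd_is_one f g"
      unfolding gcd_is_one_def
    proof (intro allI impI)
      fix c assume "c dvd f" "c dvd g"
      then have "c dvd p * f" by (intro dvd_mult)
      then show "c dvd 1" using \<open>c dvd g\<close> prime.prems(1) unfolding gcd_is_one_def by blast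
    qed
    ultimately have "f dvd a'" using prime.IH by blast
    then show ?case unfolding a' by (rule mult_dvd_mono[OF dvd_refl])
  qed
qed

section \<open>Ideals\<close>

lemma module_mult: "module ((*) :: 'a::comm_ring_1 \<Rightarrow> 'a \<Rightarrow> 'a)"
  by unfold_locales (simp_all add: algebra_simps)

lemma ideal_gen_base: "a \<in> S \<Longrightarrow> a \<in> ideal_gen S"
  unfolding ideal_gen_def by (rule module.span_base[OF module_mult])

lemma ideal_gen_zero: "0 \<in> ideal_gen S"
  unfolding ideal_gen_def by (rule module.span_zero[OF module_mult])

lemma ideal_gen_add: "a \<in> ideal_gen S \<Longrightarrow> b \<in> ideal_gen S \<Longrightarrow> a + b \<in> ideal_gen S"
  unfolding ideal_gen_def by (rule module.span_add[OF module_mult])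

lemma ideal_gen_mult: "a \<in> ideal_gen S \<Longrightarrow> c * a \<in> ideal_gen S"
  unfolding ideal_gen_def by (rule module.span_scale[OF module_mult])

lemma ideal_gen_uminus: "a \<in> ideal_gen S \<Longrightarrow> - a \<in> ideal_gen S"
  using ideal_gen_mult[of a S "-1"] by simp

lemma ideal_gen_sum: "(\<And>i. i \<in> I \<Longrightarrow> h i \<in> ideal_gen S) \<Longrightarrow> sum h I \<in> ideal_gen S"
  by (induction I rule: infinite_finite_induct) (simp_all add: ideal_gen_zero ideal_gen_add)

lemma ideal_gen_mono: "S \<subseteq> T \<Longrightarrow> ideal_gen S \<subseteq> ideal_gen T"
  unfolding ideal_gen_def by (rule module.span_mono[OF module_mult])

lemma ideal_gen_least:
  assumes "S \<subseteq> J" "0 \<in> J" "\<And>a b. a \<in> J \<Longrightarrow> b \<in> J \<Longrightarrow> a + b \<in> J" "\<And>c a. a \<in> J \<Longrightarrow> c * a \<in> J"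
  shows "ideal_gen S \<subseteq> J"
  unfolding ideal_gen_def
  by (rule module.span_minimal[OF module_mult]) (use assms in \<open>auto simp: module.subspace_def[OF module_mult]\<close>)

lemma ideal_gen_subset_kernel:
  assumes "comm_ring_hom \<phi>" "\<And>a. a \<in> S \<Longrightarrow> \<phi> a = 0" "a \<in> ideal_gen S"
  shows "\<phi> a = 0"
proof -
  interpret comm_ring_hom \<phi> by fact
  have "ideal_gen S \<subseteq> {a. \<phi> a = 0}"
    by (rule ideal_gen_least) (use assms(2) in \<open>auto simp: hom_simps\<close>)
  then show ?thesis using assms(3) by blast
qed

lemma ideal_gen_insertD:
  assumes "P \<in> ideal_gen (insert a S)"
  shows "\<exists>k. P - k * a \<in> ideal_gen S"
proof -
  have "P \<in> {x. \<exists>k. x - k * a \<in> ideal_gen S}"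
    using assms unfolding ideal_gen_def module.span_insert[OF module_mult] .
  then show ?thesis by (rule CollectD)
qed

text \<open>Turns membership into an explicit combination of the \<open>F j\<close>. The
  coefficients are attached to indices, so repeated values of F cause no trouble.\<close>

lemma ideal_gen_Un_image:
  fixes P :: "'a::comm_ring_1"
  assumes "finite J" "P \<in> ideal_gen (X \<union> F ` J)"
  shows "\<exists>A. P - (\<Sum>j\<in>J. A j * F j) \<in> ideal_gen X"
  using assms
proof (induction J arbitrary: P rule: finite_induct)
  case empty
  then show ?case by simp
next
  case (insert j J)
  have "P \<in> ideal_gen (insert (F j) (X \<union> F ` J))" using insert.prems by simp
  from ideal_gen_insertD[OF this] obtain k where "P - k * F j \<in> ideal_gen (X \<union> F ` J)" ..
  from insert.IH[OF this] obtain A where A: "P - k * F j - (\<Sum>j\<in>J. A j * F j) \<in> ideal_gen X" ..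
  have "(\<Sum>i\<in>J. (A(j := k)) i * F i) = (\<Sum>i\<in>J. A i * F i)"
    using insert.hyps by (intro sum.cong) auto
  then have "P - (\<Sum>i\<in>insert j J. (A(j := k)) i * F i) = P - k * F j - (\<Sum>j\<in>J. A j * F j)"
    using insert.hyps by (simp add: diff_diff_eq)
  then have "P - (\<Sum>i\<in>insert j J. (A(j := k)) i * F i) \<in> ideal_gen X"
    using A by (simp only:)
  then show ?case by (rule exI[where x = "A(j := k)"])
qed

lemma minimal_generating_setI:
  assumes "ideal_gen S = I" "\<And>a. a \<in> S \<Longrightarrow> a \<notin> ideal_gen (S - {a})"
  shows "minimal_generating_set I S"
proof -
  have "ideal_gen T \<noteq> I" if T: "T \<subset> S" for T
  proof
    assume I: "ideal_gen T = I"
    obtain a where a: "a \<in> S" "a \<notin> T" using T by blast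
    have "T \<subseteq> S - {a}" using T a by blast
    then have "ideal_gen T \<subseteq> ideal_gen (S - {a})" by (rule ideal_gen_mono)
    moreover have "a \<in> ideal_gen T" unfolding I assms(1)[symmetric] using a(1) by (rule ideal_gen_base)
    ultimately show False using assms(2)[OF a(1)] by blast
  qed
  then show ?thesis using assms(1) by (simp add: minimal_generating_set_def)
qed

text \<open>Evaluation respects congruences between the substituted values. Needed for congruences
  modulo \<open>\<Phi>\<close>.\<close>

lemma dvd_eval_hom_diff:
  assumes \<phi>: "comm_ring_hom \<phi>" and c: "\<And>v. c dvd h v - h' v"
  shows "c dvd eval_hom \<phi> h p - eval_hom \<phi> h' p"
proof -
  interpret comm_ring_hom \<phi> by (rule \<phi>)
  show ?thesis
  proof (induction p rule: mpoly_induct)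
    case (const a)
    show ?case by (simp add: eval_hom_MConst)
  next
    case (var v)
    show ?case using c[of v] by (simp only: eval_hom_MVar)
  next
    case (add p q)
    have "eval_hom \<phi> h (p + q) - eval_hom \<phi> h' (p + q) =
        (eval_hom \<phi> h p - eval_hom \<phi> h' p) + (eval_hom \<phi> h q - eval_hom \<phi> h' q)"
      by (simp add: eval_hom_add)
    then show ?case using dvd_add[OF add] by simp
  next
    case (mult p q)
    have "eval_hom \<phi> h (p * q) - eval_hom \<phi> h' (p * q) =
        eval_hom \<phi> h p * (eval_hom \<phi> h q - eval_hom \<phi> h' q) +
        (eval_hom \<phi> h p - eval_hom \<phi> h' p) * eval_hom \<phi> h' q"
      by (simp add: eval_hom_mult algebra_simps)
    then show ?case using dvd_add[OF dvd_mult[OF mult(2)] dvd_mult2[OF mult(1)]] by simp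
  qed
qed

section \<open>The Rees algebra relations\<close>

definition degree_part :: "nat \<Rightarrow> ('v, 'a::comm_monoid_add) mpoly \<Rightarrow> ('v, 'a) mpoly" where
  "degree_part e p = (\<Sum>m\<in>{m\<in>Poly_Mapping.keys p. mdeg m = e}.
     Poly_Mapping.single m (Poly_Mapping.lookup p m))"

lemma lookup_degree_part:
  "Poly_Mapping.lookup (degree_part e p) m = (if mdeg m = e then Poly_Mapping.lookup p m else 0)"
  by (auto simp: degree_part_def lookup_sum lookup_single when_def in_keys_iff if_distrib sum.delta cong: if_cong)

lemma keys_degree_part:
  "Poly_Mapping.keys (degree_part e p) = {m\<in>Poly_Mapping.keys p. mdeg m = e}"
  by (auto simp: in_keys_iff lookup_degree_part split: if_splits)

lemma form_degree_part: "form e (degree_part e p)"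
  by (simp add: form_def keys_degree_part)

lemma sum_degree_part: "p = (\<Sum>e\<in>mdeg ` Poly_Mapping.keys p. degree_part e p)"
proof (rule poly_mapping_eqI)
  fix m
  have "(\<Sum>e\<in>mdeg ` Poly_Mapping.keys p. Poly_Mapping.lookup (degree_part e p) m) =
      (if mdeg m \<in> mdeg ` Poly_Mapping.keys p then Poly_Mapping.lookup p m else 0)"
    by (simp add: lookup_degree_part)
  also have "\<dots> = Poly_Mapping.lookup p m" by (auto simp: in_keys_iff)
  finally show "Poly_Mapping.lookup p m =
      Poly_Mapping.lookup (\<Sum>e\<in>mdeg ` Poly_Mapping.keys p. degree_part e p) m"
    by (simp add: lookup_sum)
qed

abbreviation rees_hom :: "('v \<Rightarrow> 'r::comm_ring_1) \<Rightarrow> ('v, 'r) mpoly \<Rightarrow> 'r poly" where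
  "rees_hom h \<equiv> eval_hom (\<lambda>c. [:c:]) (\<lambda>v. Polynomial.monom (h v) 1)"

lemma comm_ring_hom_rees_hom: "comm_ring_hom (rees_hom h)"
  by (rule comm_ring_hom.comm_ring_hom_eval_hom[OF comm_ring_hom_const_poly])

text \<open>The variable t records the degree in the \<open>y\<^sub>v\<close>, so a relation can be
  examined one homogeneous component at a time, with t eliminated.\<close>

lemma coeff_rees_hom:
  fixes h :: "'v \<Rightarrow> 'r::comm_ring_1"
  shows "coeff (rees_hom h p) e = eval_hom (\<lambda>c. c) h (degree_part e p)"
proof -
  interpret c: comm_ring_hom "\<lambda>c::'r. [:c:]" by (rule comm_ring_hom_const_poly)
  have "meval (\<lambda>v. Polynomial.monom (h v) 1) m = Polynomial.monom (meval h m) (mdeg m)" for m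
  proof -
    have "(\<lambda>v. Polynomial.monom (h v) 1) = (\<lambda>v. Polynomial.monom 1 1 * [:h v:])"
      by (simp add: mult.commute smult_monom)
    then have "meval (\<lambda>v. Polynomial.monom (h v) 1) m = Polynomial.monom 1 1 ^ mdeg m * meval (\<lambda>v. [:h v:]) m"
      by (simp only: meval_scale)
    also have "meval (\<lambda>v. [:h v:]) m = [:meval h m:]"
      by (simp add: meval_def c.hom_simps)
    finally show ?thesis by (simp add: monom_power smult_monom mult.commute)
  qed
  then have "rees_hom h p = (\<Sum>m\<in>Poly_Mapping.keys p.
      Polynomial.monom (Poly_Mapping.lookup p m * meval h m) (mdeg m))"
    by (simp add: eval_hom_meval smult_monom)
  then have "coeff (rees_hom h p) e = (\<Sum>m\<in>Poly_Mapping.keys p.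
      if mdeg m = e then Poly_Mapping.lookup p m * meval h m else 0)"
    by (simp add: coeff_sum)
  also have "\<dots> = (\<Sum>m\<in>{m\<in>Poly_Mapping.keys p. mdeg m = e}. Poly_Mapping.lookup p m * meval h m)"
    by (simp add: sum.inter_filter)
  also have "\<dots> = eval_hom (\<lambda>c. c) h (degree_part e p)"
    by (simp add: eval_hom_meval keys_degree_part lookup_degree_part)
  finally show ?thesis .
qed

section \<open>The homomorphism to \<open>R[s, w]\<close>\<close>

text \<open>
  \<open>R[s, w]\<close> is realized as the polynomial ring with \<open>x\<^sub>v\<close> at index \<open>Some (Some v)\<close>,
  \<open>s\<close> at \<open>Some None\<close> and \<open>w\<close> at \<open>None\<close>.
\<close>

type_synonym ('n, 'k) Rsw = "('n option option option, 'k) mpoly"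

abbreviation s_var :: "('n, 'k::field) Rsw" where "s_var \<equiv> MVar (Some None)"
abbreviation w_var :: "('n, 'k::field) Rsw" where "w_var \<equiv> MVar None"

definition emb :: "('n, 'k::field) R \<Rightarrow> ('n, 'k) Rsw" where
  "emb = eval_hom MConst (\<lambda>v. MVar (Some (Some v)))"

fun sigma_var :: "'n option \<Rightarrow> ('n, 'k::field) Rsw" where
  "sigma_var (Some i) = MVar (Some (Some (Some i))) * s_var"
| "sigma_var None = w_var"

definition sigma :: "('n, 'k::field) Ry \<Rightarrow> ('n, 'k) Rsw" where
  "sigma = eval_hom emb sigma_var"

interpretation MConst: comm_ring_hom "MConst :: 'a::comm_ring_1 \<Rightarrow> ('v, 'a) mpoly"
  by (rule comm_ring_hom_MConst)

interpretation emb: comm_ring_hom "emb :: ('n, 'k::field) R \<Rightarrow> ('n, 'k) Rsw"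
  unfolding emb_def by (rule MConst.comm_ring_hom_eval_hom)

interpretation sigma: comm_ring_hom "sigma :: ('n, 'k::field) Ry \<Rightarrow> ('n, 'k) Rsw"
  unfolding sigma_def by (rule emb.comm_ring_hom_eval_hom)

lemma emb_simps [simp]: "emb (MConst c) = MConst c" "emb (MVar v) = MVar (Some (Some v))"
  by (simp_all add: emb_def MConst.eval_hom_MConst MConst.eval_hom_MVar)

lemma sigma_simps [simp]:
  "sigma (MConst p) = emb p" "sigma (xvar v) = MVar (Some (Some v))" "sigma (yvar v) = sigma_var v"
  by (simp_all add: sigma_def emb.eval_hom_MConst emb.eval_hom_MVar xvar_def yvar_def)

lemma sigma_p_gen: "sigma (p_gen i j) = 0"
  by (simp add: p_gen_def sigma.hom_simps algebra_simps)

text \<open>The exponent of the image of \<open>x\<^sup>a y\<^sup>b\<close> under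
  \<open>sigma\<close>: each \<open>y\<^sub>i\<close> with \<open>i \<le> n\<close> adds one
  \<open>x\<^sub>i\<close> and one s.\<close>

definition expo :: "('n::finite option \<Rightarrow>\<^sub>0 nat) \<Rightarrow> ('n option \<Rightarrow>\<^sub>0 nat) \<Rightarrow> 'n option option option \<Rightarrow>\<^sub>0 nat" where
  "expo a b = Abs_poly_mapping (\<lambda>u. case u of
     None \<Rightarrow> Poly_Mapping.lookup b None
   | Some None \<Rightarrow> \<Sum>i\<in>UNIV. Poly_Mapping.lookup b (Some i)
   | Some (Some None) \<Rightarrow> Poly_Mapping.lookup a None
   | Some (Some (Some i)) \<Rightarrow> Poly_Mapping.lookup a (Some i) + Poly_Mapping.lookup b (Some i))"

lemma lookup_expo [simp]:
  "Poly_Mapping.lookup (expo a b) None = Poly_Mapping.lookup b None"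
  "Poly_Mapping.lookup (expo a b) (Some None) = (\<Sum>i\<in>UNIV. Poly_Mapping.lookup b (Some i))"
  "Poly_Mapping.lookup (expo a b) (Some (Some None)) = Poly_Mapping.lookup a None"
  "Poly_Mapping.lookup (expo a b) (Some (Some (Some i))) =
     Poly_Mapping.lookup a (Some i) + Poly_Mapping.lookup b (Some i)"
  by (simp_all add: expo_def)

lemma prod_UNIV_option:
  "(\<Prod>v\<in>(UNIV :: 'a::finite option set). h v) = h None * (\<Prod>i\<in>UNIV. h (Some i))"
  by (simp add: UNIV_option_conv prod.reindex)

lemma sum_UNIV_option:
  "(\<Sum>v\<in>(UNIV :: 'a::finite option set). h v) = h None + (\<Sum>i\<in>UNIV. h (Some i))"
  by (simp add: UNIV_option_conv sum.reindex)

definition mon :: "('n option \<Rightarrow>\<^sub>0 nat) \<Rightarrow> ('n option \<Rightarrow>\<^sub>0 nat) \<Rightarrow> ('n, 'k::field) Ry" where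
  "mon a b = Poly_Mapping.single b (Poly_Mapping.single a 1)"

lemma mon_add: "mon (a + a') (b + b') = mon a b * mon a' b'"
  by (simp add: mon_def mult_single)

lemma single_single_eq:
  "Poly_Mapping.single b (Poly_Mapping.single a c) = MConst (MConst c) * mon a b"
  by (simp add: mon_def MConst_def mult_single)

lemma sigma_mon:
  "sigma (mon a b :: ('n::finite, 'k::field) Ry) = Poly_Mapping.single (expo a b) 1"
proof -
  have "sigma (mon a b :: ('n, 'k) Ry) = meval (\<lambda>v. MVar (Some (Some v))) a * meval sigma_var b"
    unfolding mon_def sigma_def by (simp add: emb.eval_hom_monomial)
      (simp add: emb_def MConst.eval_hom_monomial MConst.hom_one)
  also have "\<dots> = meval MVar (expo a b)"
    by (simp add: meval_UNIV prod_UNIV_option power_mult_distrib power_add prod.distrib power_sum mult_ac)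
  finally show ?thesis by (simp add: meval_MVar)
qed

lemma sigma_term: "sigma (MConst (MConst c) * mon a b) = Poly_Mapping.single (expo a b) c"
proof -
  have "sigma (MConst (MConst c) * mon a b) = MConst c * Poly_Mapping.single (expo a b) 1"
    by (simp add: sigma.hom_mult sigma_mon)
  then show ?thesis by (simp add: MConst_def mult_single)
qed

lemma single_one_eq_iff:
  "Poly_Mapping.single m (1::'a::zero_neq_one) = Poly_Mapping.single n 1 \<longleftrightarrow> m = n"
  by (metis keys_single singleton_inject zero_neq_one)

lemma Ry_induct [case_names mon add]:
  fixes p :: "('n, 'k::field) Ry"
  assumes mon: "\<And>a b c. P (MConst (MConst c) * mon a b)"
    and add: "\<And>p q. P p \<Longrightarrow> P q \<Longrightarrow> P (p + q)"
  shows "P p"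
proof -
  have zero: "P 0" using mon[of 0] by (simp add: MConst.hom_simps)
  show ?thesis
  proof (induction p rule: poly_mapping_additive_induct)
    case (single b p)
    show ?case
      by (induction p rule: poly_mapping_additive_induct)
        (simp_all add: zero mon add single_single_eq single_add)
  qed (simp_all add: zero add)
qed

section \<open>Weights, and monomials as images up to powers of s\<close>

definition wt :: "('n::finite option option option \<Rightarrow>\<^sub>0 nat) \<Rightarrow> int" where
  "wt m = (\<Sum>i\<in>UNIV. int (Poly_Mapping.lookup m (Some (Some (Some i))))) - int (Poly_Mapping.lookup m (Some None))"

lemma wt_add: "wt (m + n) = wt m + wt n"
  by (simp add: wt_def lookup_add sum.distrib)

lemma wt_expo: "wt (expo a b) = (\<Sum>i\<in>UNIV. int (Poly_Mapping.lookup a (Some i)))"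
  by (simp add: wt_def sum.distrib)

text \<open>Both \<open>x\<^sub>i s\<close> and w have weight 0, so the weight of a monomial in the
  image counts the factors \<open>x\<^sub>1, \<dots>, x\<^sub>n\<close> of the coefficient
  alone.\<close>

lemma wt_sigma:
  assumes "m \<in> Poly_Mapping.keys (sigma (P :: ('n::finite, 'k::field) Ry))"
  shows "0 \<le> wt m"
  using assms
proof (induction P arbitrary: m rule: Ry_induct)
  case (mon a b c)
  then have "m = expo a b"
    by (simp add: sigma_term split: if_splits)
  then show ?case by (simp add: wt_expo sum_nonneg)
next
  case (add p q)
  then show ?case using keys_add[of "sigma p" "sigma q"] by (auto simp: sigma.hom_add)
qed

text \<open>Decides in \<open>weight_monomial\<close> how many factors of each
  \<open>x\<^sub>i\<close> are paired with an s.\<close>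

lemma bounded_sum_exists:
  fixes \<alpha> :: "'n::finite \<Rightarrow> nat"
  shows "c \<le> sum \<alpha> UNIV \<Longrightarrow> \<exists>\<beta>. (\<forall>i. \<beta> i \<le> \<alpha> i) \<and> sum \<beta> UNIV = c"
proof (induction c)
  case 0
  then show ?case by (intro exI[of _ "\<lambda>_. 0"]) simp
next
  case (Suc c)
  then obtain \<beta> where \<beta>: "\<And>i. \<beta> i \<le> \<alpha> i" "sum \<beta> UNIV = c" by auto
  have "\<exists>j. \<beta> j < \<alpha> j"
  proof (rule ccontr)
    assume "\<not> ?thesis"
    then have "sum \<alpha> UNIV \<le> sum \<beta> UNIV" by (intro sum_mono) (simp add: not_less)
    then show False using \<beta> Suc.prems by simp
  qed
  then obtain j where j: "\<beta> j < \<alpha> j" by blast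
  have "sum (\<lambda>i. \<beta> i + (if i = j then 1 else 0)) UNIV = Suc c"
    using \<beta>(2) by (simp add: sum.distrib)
  moreover have "\<beta> i + (if i = j then 1 else 0) \<le> \<alpha> i" for i
    using \<beta>(1)[of i] j by auto
  ultimately show ?case by (intro exI[of _ "\<lambda>i. \<beta> i + (if i = j then 1 else 0)"]) simp
qed

text \<open>A pair \<open>x\<^sub>i s\<close> is the image of \<open>y\<^sub>i\<close>, so as many s
  as possible are paired off. The weight bound leaves at most N of them without a partner.\<close>

lemma weight_monomial:
  fixes m :: "'n::finite option option option \<Rightarrow>\<^sub>0 nat"
  assumes "- int N \<le> wt m"
  obtains i a b where "i \<le> N" "(Poly_Mapping.single m 1 :: ('n, 'k::field) Rsw) = s_var ^ i * sigma (mon a b)"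
proof -
  define \<alpha> where "\<alpha> j = Poly_Mapping.lookup m (Some (Some (Some j)))" for j
  define c where "c = Poly_Mapping.lookup m (Some None)"
  \<comment> \<open>Truncated subtraction is intended: i is 0 when there are enough
    \<open>x\<^sub>j\<close> for all s, and the surplus of s otherwise.\<close>
  define i where "i = c - sum \<alpha> UNIV"
  have "int c - int N \<le> int (sum \<alpha> UNIV)" using assms by (simp add: wt_def \<alpha>_def c_def)
  then have "i \<le> N" unfolding i_def by linarith
  have "c - i \<le> sum \<alpha> UNIV" by (simp add: i_def)
  then obtain \<beta> where \<beta>: "\<And>j. \<beta> j \<le> \<alpha> j" "sum \<beta> UNIV = c - i"
    using bounded_sum_exists by blast
  define a where "a = Abs_poly_mapping (\<lambda>v. case v of
      None \<Rightarrow> Poly_Mapping.lookup m (Some (Some None)) | Some j \<Rightarrow> \<alpha> j - \<beta> j)"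
  define b where "b = Abs_poly_mapping (\<lambda>v. case v of
      None \<Rightarrow> Poly_Mapping.lookup m None | Some j \<Rightarrow> \<beta> j)"
  have "m = Poly_Mapping.single (Some None) i + expo a b"
  proof (rule poly_mapping_eqI)
    fix u :: "'n option option option"
    consider "u = None" | "u = Some None" | "u = Some (Some None)" | j where "u = Some (Some (Some j))"
      by (metis not_None_eq)
    then show "Poly_Mapping.lookup m u = Poly_Mapping.lookup (Poly_Mapping.single (Some None) i + expo a b) u"
      using \<beta> by cases (simp_all add: lookup_add lookup_single a_def b_def \<alpha>_def, simp add: i_def c_def)
  qed
  then have "(Poly_Mapping.single m 1 :: ('n, 'k) Rsw) = s_var ^ i * sigma (mon a b)"
    by (simp add: MVar_power sigma_mon mult_single)
  with \<open>i \<le> N\<close> show ?thesis using that by blast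
qed

section \<open>The kernel of \<open>sigma\<close>\<close>

abbreviation p_ideal :: "('n::linorder, 'k::field) Ry set" where
  "p_ideal \<equiv> ideal_gen {p_gen i j | i j. i < j}"

lemma p_gen_in_p_ideal: "(p_gen i j :: ('n::linorder, 'k::field) Ry) \<in> p_ideal"
proof (cases i j rule: linorder_cases)
  case less then show ?thesis by (intro ideal_gen_base) blast
next
  case equal then show ?thesis by (simp add: p_gen_def ideal_gen_zero)
next
  case greater
  then have "- (p_gen j i :: ('n, 'k) Ry) \<in> p_ideal" by (intro ideal_gen_uminus ideal_gen_base) blast
  moreover have "- (p_gen j i :: ('n, 'k) Ry) = p_gen i j" by (simp add: p_gen_def)
  ultimately show ?thesis by (simp only:)
qed

lemma x_mon: "xvar v = mon (Poly_Mapping.single v 1) 0"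
  by (simp add: xvar_def mon_def MVar_def MConst_def)

lemma y_mon: "yvar v = mon 0 (Poly_Mapping.single v 1)"
  by (simp add: yvar_def mon_def MVar_def)

lemma split_single:
  fixes m :: "'v \<Rightarrow>\<^sub>0 nat"
  assumes "0 < Poly_Mapping.lookup m v"
  obtains m' where "m = Poly_Mapping.single v 1 + m'"
proof
  show "m = Poly_Mapping.single v 1 + (m - Poly_Mapping.single v 1)"
    using assms by (intro poly_mapping_eqI) (auto simp: lookup_add lookup_minus lookup_single when_def)
qed

text \<open>Exchanging \<open>x\<^sub>j y\<^sub>i\<close> for \<open>x\<^sub>i y\<^sub>j\<close>
  changes a monomial by a multiple of \<open>p_gen i j\<close>. At most one exchange brings a
  variable \<open>y\<^sub>j\<close> of the second monomial into the first; it is then cancelled from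
  both, which lowers the degree in \<open>y\<^sub>1, \<dots>, y\<^sub>n\<close>.\<close>

lemma mon_congruent:
  fixes a b a' b' :: "'n::{finite, linorder} option \<Rightarrow>\<^sub>0 nat"
  assumes "expo a b = expo a' b'"
  shows "(mon a b :: ('n, 'k::field) Ry) - mon a' b' \<in> p_ideal"
  using assms
proof (induction "\<Sum>i\<in>UNIV. Poly_Mapping.lookup b (Some i)" arbitrary: a b a' b')
  case 0
  note e = arg_cong[OF 0(2), of Poly_Mapping.lookup, THEN fun_cong]
  have b: "Poly_Mapping.lookup b (Some i) = 0" and b': "Poly_Mapping.lookup b' (Some i) = 0" for i
    using 0(1) e[of "Some None"] by simp_all
  have "b = b'"
  proof (rule poly_mapping_eqI)
    fix v show "Poly_Mapping.lookup b v = Poly_Mapping.lookup b' v"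
      using b b' e[of None] by (cases v) simp_all
  qed
  moreover have "a = a'"
  proof (rule poly_mapping_eqI)
    fix v show "Poly_Mapping.lookup a v = Poly_Mapping.lookup a' v"
      using b b' e[of "Some (Some v)"] by (cases v) simp_all
  qed
  ultimately show ?case by (simp add: ideal_gen_zero)
next
  case (Suc k)
  note e = arg_cong[OF Suc(3), of Poly_Mapping.lookup, THEN fun_cong]
  have exists_pos: "\<exists>i. 0 < h i" if "Suc k = sum h UNIV" for h :: "'n \<Rightarrow> nat"
    using that by (metis gr0I sum.neutral Zero_not_Suc)
  obtain j where j: "0 < Poly_Mapping.lookup b' (Some j)"
    using exists_pos Suc(2) e[of "Some None"] by auto
  then obtain b3 where b3: "b' = Poly_Mapping.single (Some j) 1 + b3" by (rule split_single)
  have "\<exists>a1 b2. (mon a b :: ('n, 'k) Ry) - mon a1 (Poly_Mapping.single (Some j) 1 + b2) \<in> p_ideal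
      \<and> expo a b = expo a1 (Poly_Mapping.single (Some j) 1 + b2)"
  proof (cases "0 < Poly_Mapping.lookup b (Some j)")
    case True
    then obtain b2 where "b = Poly_Mapping.single (Some j) 1 + b2" by (rule split_single)
    then show ?thesis using ideal_gen_zero by (intro exI[of _ a] exI[of _ b2]) simp
  next
    case False
    \<comment> \<open>The exponent of \<open>x\<^sub>j\<close> is the same in both images, and
      positive in the second because of \<open>y\<^sub>j\<close>. As \<open>y\<^sub>j\<close> is
      missing from the first monomial, \<open>x\<^sub>j\<close> must occur there.\<close>
    then have "0 < Poly_Mapping.lookup a (Some j)" using j e[of "Some (Some (Some j))"] by simp
    then obtain a0 where a0: "a = Poly_Mapping.single (Some j) 1 + a0" by (rule split_single)
    obtain i where "0 < Poly_Mapping.lookup b (Some i)" using exists_pos Suc(2) by auto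
    then obtain b0 where b0: "b = Poly_Mapping.single (Some i) 1 + b0" by (rule split_single)
    let ?a1 = "Poly_Mapping.single (Some i) 1 + a0" and ?b1 = "Poly_Mapping.single (Some j) 1 + b0"
    have ab: "(mon a b :: ('n, 'k) Ry) = mon a0 b0 * (xvar (Some j) * yvar (Some i))"
      unfolding a0 b0 x_mon y_mon by (simp flip: mon_add add: ac_simps)
    have ab1: "(mon ?a1 ?b1 :: ('n, 'k) Ry) = mon a0 b0 * (xvar (Some i) * yvar (Some j))"
      unfolding x_mon y_mon by (simp flip: mon_add add: ac_simps)
    have diff: "(mon a b :: ('n, 'k) Ry) - mon ?a1 ?b1 = mon a0 b0 * p_gen i j"
      unfolding ab ab1 by (simp add: p_gen_def right_diff_distrib)
    then have "sigma (mon a b - mon ?a1 ?b1 :: ('n, 'k) Ry) = 0"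
      by (simp add: sigma.hom_mult sigma_p_gen)
    then have "expo a b = expo ?a1 ?b1"
      by (simp add: sigma.hom_diff sigma_mon single_one_eq_iff)
    moreover have "(mon a b :: ('n, 'k) Ry) - mon ?a1 ?b1 \<in> p_ideal"
      unfolding diff by (rule ideal_gen_mult[OF p_gen_in_p_ideal])
    ultimately show ?thesis by blast
  qed
  then obtain a1 b2 where 1: "(mon a b :: ('n, 'k) Ry) - mon a1 (Poly_Mapping.single (Some j) 1 + b2) \<in> p_ideal"
    and e1: "expo a b = expo a1 (Poly_Mapping.single (Some j) 1 + b2)" by blast
  have split: "(mon c (Poly_Mapping.single (Some j) 1 + d) :: ('n, 'k) Ry) = yvar (Some j) * mon c d" for c d
    using mon_add[of 0 c] by (simp add: y_mon)
  \<comment> \<open>The variable \<open>y\<^sub>j\<close> is cancelled after applying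
    \<open>sigma\<close>, in a domain; this gives the equality of exponents that the induction
    hypothesis asks for.\<close>
  have "sigma (yvar (Some j) * mon a1 b2 :: ('n, 'k) Ry) = sigma (yvar (Some j) * mon a' b3)"
    using e1 Suc(3) by (simp only: split[symmetric] sigma_mon b3)
  moreover have "sigma (yvar (Some j) :: ('n, 'k) Ry) \<noteq> 0"
    by (simp add: y_mon sigma_mon flip: keys_eq_empty)
  ultimately have "sigma (mon a1 b2 :: ('n, 'k) Ry) = sigma (mon a' b3)"
    by (simp only: sigma.hom_mult mult_left_cancel not_False_eq_True)
  then have e2: "expo a1 b2 = expo a' b3" by (simp add: sigma_mon single_one_eq_iff)
  have "Suc k = (\<Sum>i\<in>UNIV. Poly_Mapping.lookup (Poly_Mapping.single (Some j) 1 + b2) (Some i))"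
    using Suc(2) arg_cong[OF e1, of "\<lambda>m. Poly_Mapping.lookup m (Some None)"] by simp
  also have "\<dots> = Suc (\<Sum>i\<in>UNIV. Poly_Mapping.lookup b2 (Some i))"
    by (simp add: lookup_add lookup_single sum.distrib when_def)
  finally have "(mon a1 b2 :: ('n, 'k) Ry) - mon a' b3 \<in> p_ideal"
    using Suc(1)[OF _ e2] by simp
  then have "yvar (Some j) * ((mon a1 b2 :: ('n, 'k) Ry) - mon a' b3) \<in> p_ideal"
    by (rule ideal_gen_mult)
  then have "(mon a1 (Poly_Mapping.single (Some j) 1 + b2) :: ('n, 'k) Ry) - mon a' b' \<in> p_ideal"
    by (simp only: split b3 right_diff_distrib)
  from ideal_gen_add[OF 1 this] show ?case by simp
qed

text \<open>Every monomial is congruent to a chosen representative of its image. Hence P is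
  congruent to a linear lift of \<open>sigma P\<close>, and the lift of 0 is 0.\<close>

lemma sigma_kernel:
  fixes P :: "('n::{finite, linorder}, 'k::field) Ry"
  assumes "sigma P = 0"
  shows "P \<in> p_ideal"
proof -
  \<comment> \<open>The choice is meaningful for exponents of the form \<open>expo a b\<close>, and
    these are the ones that occur in \<open>sigma P\<close>.\<close>
  define rho :: "('n option option option \<Rightarrow>\<^sub>0 nat) \<Rightarrow> ('n, 'k) Ry" where
    "rho m = (SOME M. \<exists>a b. M = mon a b \<and> expo a b = m)" for m
  have rho: "mon a b - rho (expo a b) \<in> p_ideal" for a b
  proof -
    have "\<exists>M a' b'. M = (mon a' b' :: ('n, 'k) Ry) \<and> expo a' b' = expo a b" by blast
    then have "\<exists>a' b'. rho (expo a b) = mon a' b' \<and> expo a' b' = expo a b"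
      unfolding rho_def by (rule someI_ex)
    then obtain a' b' where 1: "rho (expo a b) = mon a' b'" and 2: "expo a' b' = expo a b"
      by (elim exE conjE) (rule that)
    show ?thesis unfolding 1 by (rule mon_congruent) (rule 2[symmetric])
  qed
  define lift where "lift Q = (\<Sum>m\<in>Poly_Mapping.keys Q. MConst (MConst (Poly_Mapping.lookup Q m)) * rho m)" for Q
  have lift_add: "lift (p + q) = lift p + lift q" for p q
    unfolding lift_def
    by (rule sum_keys_add[of "\<lambda>m c. MConst (MConst c) * rho m"]) (simp_all add: MConst.hom_simps distrib_right)
  have "P - lift (sigma P) \<in> p_ideal" for P
  proof (induction P rule: Ry_induct)
    case (mon a b c)
    have "lift (sigma (MConst (MConst c) * mon a b)) = MConst (MConst c) * rho (expo a b)"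
      unfolding sigma_term by (cases "c = 0") (simp_all add: lift_def MConst.hom_simps)
    then have "MConst (MConst c) * mon a b - lift (sigma (MConst (MConst c) * mon a b)) =
        MConst (MConst c) * (mon a b - rho (expo a b))"
      by (simp add: right_diff_distrib)
    then show ?case using ideal_gen_mult[OF rho] by simp
  next
    case (add p q)
    have "p + q - lift (sigma (p + q)) = (p - lift (sigma p)) + (q - lift (sigma q))"
      by (simp add: sigma.hom_add lift_add)
    then show ?case using ideal_gen_add[OF add] by (simp only:)
  qed
  from this[of P] show ?thesis using assms by (simp add: lift_def)
qed

section \<open>Generation of the presentation ideal\<close>

definition Phi :: "('n, 'k::field) R \<Rightarrow> ('n, 'k) R \<Rightarrow> ('n, 'k) Rsw" where
  "Phi f g = emb f * w_var - emb g * s_var"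

text \<open>Gives a retraction of \<open>R[s, w]\<close> onto R; s goes to 1 and not to 0, so that a
  divisor of \<open>g s\<close> yields a divisor of g.\<close>

definition ret_var :: "'n option option option \<Rightarrow> ('n, 'k::field) R" where
  "ret_var u = (case u of None \<Rightarrow> 0 | Some None \<Rightarrow> 1 | Some (Some v) \<Rightarrow> MVar v)"

definition ret :: "('n, 'k::field) Rsw \<Rightarrow> ('n, 'k) R" where
  "ret = eval_hom MConst ret_var"

interpretation ret: comm_ring_hom "ret :: ('n, 'k::field) Rsw \<Rightarrow> ('n, 'k) R"
  unfolding ret_def by (rule MConst.comm_ring_hom_eval_hom)

lemma ret_simps [simp]: "ret (MConst c) = MConst c" "ret (MVar u) = ret_var u"
  by (simp_all add: ret_def MConst.eval_hom_MConst MConst.eval_hom_MVar)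

lemma ret_emb [simp]: "ret (emb p) = p"
  by (induction p rule: mpoly_induct) (simp_all add: ret_var_def emb.hom_simps ret.hom_simps)

lemma emb_single: "emb (Poly_Mapping.single a c) = Poly_Mapping.single (expo a 0) c"
  for a :: "'n::finite option \<Rightarrow>\<^sub>0 nat" and c :: "'k::field"
proof -
  have "emb (Poly_Mapping.single a c) = sigma (MConst (Poly_Mapping.single a c) :: ('n, 'k) Ry)"
    by simp
  also have "(MConst (Poly_Mapping.single a c) :: ('n, 'k) Ry) = MConst (MConst c) * mon a 0"
    by (simp add: MConst_def mon_def mult_single)
  finally show ?thesis by (simp only: sigma_term)
qed

lemma keys_emb:
  fixes p :: "('n::finite, 'k::field) R"
  assumes "m \<in> Poly_Mapping.keys (emb p)"
  shows "\<exists>a. m = expo a 0"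
  using assms
proof (induction p rule: poly_mapping_additive_induct)
  case zero then show ?case by (simp add: emb.hom_zero)
next
  case (single a c) then show ?case by (auto simp: emb_single split: if_splits)
next
  case (add p q) then show ?case using keys_add[of "emb p" "emb q"] by (auto simp: emb.hom_add)
qed

lemma expo_inj: "expo a 0 = expo a' 0 \<Longrightarrow> a = a'"
proof (rule poly_mapping_eqI)
  fix v assume "expo a 0 = expo a' 0"
  then have "Poly_Mapping.lookup (expo a 0) (Some (Some v)) = Poly_Mapping.lookup (expo a' 0) (Some (Some v))"
    by simp
  then show "Poly_Mapping.lookup a v = Poly_Mapping.lookup a' v" by (cases v) simp_all
qed

lemma lookup_emb: "Poly_Mapping.lookup (emb p) (expo a 0) = Poly_Mapping.lookup p a"
  for p :: "('n::finite, 'k::field) R"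
proof (induction p rule: poly_mapping_additive_induct)
  case zero then show ?case by (simp add: emb.hom_zero)
next
  case (single b c) then show ?case using expo_inj[of b a] by (auto simp: emb_single lookup_single when_def)
next
  case (add p q) then show ?case by (simp add: emb.hom_add lookup_add)
qed

lemma lookup_mult_MVar:
  "Poly_Mapping.lookup (p * MVar u) (m + Poly_Mapping.single u 1) = Poly_Mapping.lookup p m"
  for p :: "('v, 'a::comm_ring_1) mpoly"
proof (induction p rule: poly_mapping_additive_induct)
  case (single n c)
  then show ?case by (simp add: MVar_def mult_single lookup_single when_def)
qed (simp_all add: distrib_right lookup_add)

lemma lookup_mult_MVar_zero:
  assumes "Poly_Mapping.lookup m u = 0"
  shows "Poly_Mapping.lookup (p * MVar u) m = (0 :: 'a::comm_ring_1)"
proof (rule ccontr)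
  assume "Poly_Mapping.lookup (p * MVar u) m \<noteq> 0"
  then have "m \<in> Poly_Mapping.keys (p * MVar u)" by (simp add: in_keys_iff)
  then obtain a b where "b \<in> Poly_Mapping.keys (MVar u :: ('b, 'a) mpoly)" "m = a + b"
    using keys_mult[of p "MVar u"] by blast
  then show False using assms by (simp add: MVar_def lookup_add)
qed

text \<open>Degrees add in a domain, so a factor of a nonzero polynomial free of s and w is itself
  free of them, and \<open>ret\<close> only forgets the embedding.\<close>

lemma dvd_emb_in_range:
  fixes c :: "('n::{finite, linorder}, 'k::field) Rsw"
  assumes "c dvd emb p" "p \<noteq> 0"
  shows "c = emb (ret c)"
proof -
  obtain k where k: "emb p = c * k" using assms(1) by (rule dvdE)
  have "emb p \<noteq> 0" using assms(2) ret_emb[of p] ret.hom_zero by metis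
  then have "k \<noteq> 0" using k by auto
  then obtain m0 where m0: "m0 \<in> Poly_Mapping.keys k"
    using poly_mapping_eq_sum[of k] by (metis equals0I sum.empty)
  \<comment> \<open>The negative of the degree in s and w, so that the lower bound of
    \<open>weight_cofactor_ge\<close> becomes an upper bound for that degree.\<close>
  define wt' where "wt' m = - int (Poly_Mapping.lookup m None + Poly_Mapping.lookup m (Some None))"
    for m :: "'n option option option \<Rightarrow>\<^sub>0 nat"
  have wt'_add: "wt' (m + n) = wt' m + wt' n" for m n by (simp add: wt'_def lookup_add)
  have ge: "0 \<le> wt' m" if "m \<in> Poly_Mapping.keys (k * c)" for m
  proof -
    have "m \<in> Poly_Mapping.keys (emb p)" using that k by (simp add: mult.commute)
    then obtain a where "m = expo a 0" using keys_emb by blast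
    then show ?thesis by (simp add: wt'_def)
  qed
  have zero: "Poly_Mapping.lookup m None = 0 \<and> Poly_Mapping.lookup m (Some None) = 0"
    if "m \<in> Poly_Mapping.keys c" for m
  proof -
    have "0 - wt' m0 \<le> wt' m"
      by (rule weight_cofactor_ge[where p = k and q = c]) (use wt'_add ge m0 that in auto)
    then show ?thesis by (simp add: wt'_def)
  qed
  have mev: "meval (\<lambda>u. emb (ret_var u) :: ('n, 'k) Rsw) m = meval MVar m" if "m \<in> Poly_Mapping.keys c" for m
    unfolding meval_def
  proof (rule prod.cong)
    fix u assume "u \<in> Poly_Mapping.keys m"
    then have "u \<noteq> None" "u \<noteq> Some None" using zero[OF that] by (metis in_keys_iff)+
    then obtain v where "u = Some (Some v)" by (metis not_None_eq)
    then show "emb (ret_var u) ^ Poly_Mapping.lookup m u = MVar u ^ Poly_Mapping.lookup m u"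
      by (simp add: ret_var_def)
  qed simp
  have "emb (ret c) = eval_hom MConst (\<lambda>u. emb (ret_var u)) c"
    by (rule hom_eqI[OF comm_ring_hom_compose[OF ret.comm_ring_hom_axioms emb.comm_ring_hom_axioms]
          MConst.comm_ring_hom_eval_hom])
      (simp_all add: MConst.eval_hom_MConst MConst.eval_hom_MVar)
  also have "\<dots> = eval_hom MConst MVar c"
    unfolding eval_hom_meval using mev by (intro sum.cong) simp_all
  also have "\<dots> = c"
    by (rule hom_eqI[OF MConst.comm_ring_hom_eval_hom comm_ring_hom_id])
      (simp_all add: MConst.eval_hom_MConst MConst.eval_hom_MVar)
  finally show ?thesis by simp
qed

text \<open>A common divisor divides \<open>f w - \<Phi> = g s\<close>. Dividing the nonzero f, it
  lies in R, and setting s to 1 shows that it divides g.\<close>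

lemma gcd_Phi:
  fixes f g :: "('n::{finite, linorder}, 'k::field) R"
  assumes "gcd_is_one f g" "f \<noteq> 0"
  shows "gcd_is_one (Phi f g) (emb f)"
  unfolding gcd_is_one_def
proof (intro allI impI)
  fix c assume c: "c dvd Phi f g" "c dvd emb f"
  have "c dvd emb f * w_var - Phi f g" using c by (intro dvd_diff dvd_mult2)
  then have "c dvd emb g * s_var" by (simp add: Phi_def)
  then have "ret c dvd ret (emb g * s_var)" by (rule ret.hom_dvd)
  then have "ret c dvd g" by (simp add: ret.hom_mult ret_var_def)
  moreover have "ret c dvd f" using ret.hom_dvd[OF c(2)] by simp
  ultimately have "ret c dvd 1" using assms(1) by (simp add: gcd_is_one_def)
  then have "emb (ret c) dvd emb 1" by (rule emb.hom_dvd)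
  then show "c dvd 1" using dvd_emb_in_range[OF c(2) assms(2)] by (simp add: emb.hom_one)
qed

text \<open>Write h for the tuple \<open>dJ_map f g\<close>. The elements
  \<open>f \<sigma>(y\<^sub>v)\<close> and \<open>s h\<^sub>v\<close> are equal for
  \<open>v \<le> n\<close> and differ by \<open>\<Phi>\<close> for \<open>v = n + 1\<close>. By
  homogeneity \<open>f\<^sup>e \<sigma>(Q)\<close> is congruent to \<open>s\<^sup>e Q(h) = 0\<close>
  modulo \<open>\<Phi>\<close>, and f is cancelled e times.\<close>

lemma Phi_dvd_sigma:
  fixes f g :: "('n::{finite, linorder}, 'k::field) R"
  assumes "gcd_is_one f g" "f \<noteq> 0" "Phi f g \<noteq> 0"
    and Q: "form e Q" "eval_hom (\<lambda>c. c) (dJ_map f g) Q = 0"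
  shows "Phi f g dvd sigma Q"
proof -
  have "Phi f g dvd eval_hom emb (\<lambda>v. emb f * sigma_var v) Q - eval_hom emb (\<lambda>v. s_var * emb (dJ_map f g v)) Q"
  proof (rule dvd_eval_hom_diff[OF emb.comm_ring_hom_axioms])
    fix v :: "'n option"
    show "Phi f g dvd emb f * sigma_var v - s_var * emb (dJ_map f g v)"
      by (cases v) (simp_all add: Phi_def emb.hom_mult mult_ac)
  qed
  moreover have "eval_hom emb (\<lambda>v. s_var * emb (dJ_map f g v)) Q = 0"
  proof -
    have "eval_hom emb (\<lambda>v. emb (dJ_map f g v)) Q = emb (eval_hom (\<lambda>c. c) (dJ_map f g) Q)"
      by (simp add: eval_hom_meval meval_def emb.hom_simps)
    then show ?thesis using Q by (simp add: eval_hom_scale emb.hom_zero)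
  qed
  ultimately have "Phi f g dvd emb f ^ e * sigma Q"
    using Q(1) by (simp add: eval_hom_scale sigma_def)
  then show ?thesis
  proof (induction e)
    case (Suc e)
    then have "Phi f g dvd (emb f ^ e * sigma Q) * emb f" by (simp add: mult_ac)
    then have "Phi f g dvd emb f ^ e * sigma Q"
      by (rule gcd_is_one_dvd_mult_cancel[OF gcd_Phi[OF assms(1,2)] assms(3)])
    then show ?case by (rule Suc.IH)
  qed simp
qed

lemma mdeg_option: "mdeg (a :: 'n::finite option \<Rightarrow>\<^sub>0 nat) =
    Poly_Mapping.lookup a None + (\<Sum>i\<in>UNIV. Poly_Mapping.lookup a (Some i))"
proof -
  have "mdeg a = (\<Sum>v\<in>UNIV. Poly_Mapping.lookup a v)"
    unfolding mdeg_def by (rule sum.mono_neutral_left) (auto simp: in_keys_iff)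
  then show ?thesis by (simp add: sum_UNIV_option)
qed

text \<open>A term of f with \<open>x\<^sub>n\<^sub>+\<^sub>1\<close> has at most
  \<open>d - 2\<close> factors among \<open>x\<^sub>1, \<dots>, x\<^sub>n\<close>, and w has weight
  0; such a term of g has at most \<open>d - 1\<close>, and s subtracts one. Nothing cancels, since
  \<open>f w\<close> is free of s and \<open>g s\<close> is free of w.\<close>

lemma Phi_low_key:
  fixes f g :: "('n::finite, 'k::field) R"
  assumes "2 \<le> d" "form (d - 1) f" "form d g" "involves_last f \<or> involves_last g"
  shows "\<exists>m\<in>Poly_Mapping.keys (Phi f g). wt m \<le> int (d - 2)"
proof -
  have x_degree: "(\<Sum>i\<in>UNIV. int (Poly_Mapping.lookup a (Some i))) < int (mdeg a)"
    if "0 < Poly_Mapping.lookup a None" for a :: "'n option \<Rightarrow>\<^sub>0 nat"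
    using that by (simp add: mdeg_option flip: of_nat_sum)
  from assms(4) show ?thesis
  proof
    assume "involves_last f"
    then obtain a where a: "a \<in> Poly_Mapping.keys f" "0 < Poly_Mapping.lookup a None"
      by (auto simp: involves_last_def)
    let ?m = "expo a 0 + Poly_Mapping.single None 1"
    have "Poly_Mapping.lookup (emb g * s_var) ?m = 0"
      by (rule lookup_mult_MVar_zero) (simp add: lookup_add lookup_single)
    then have "Poly_Mapping.lookup (Phi f g) ?m = Poly_Mapping.lookup f a"
      by (simp only: Phi_def lookup_minus lookup_mult_MVar lookup_emb) simp
    then have "?m \<in> Poly_Mapping.keys (Phi f g)" using a by (simp add: in_keys_iff)
    moreover have "wt ?m \<le> int (d - 2)"
    proof -
      have "wt ?m = (\<Sum>i\<in>UNIV. int (Poly_Mapping.lookup a (Some i)))"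
        by (simp only: wt_add wt_expo) (simp add: wt_def lookup_single)
      moreover have "mdeg a = d - 1" using a assms(2) by (simp add: form_def)
      ultimately show ?thesis using x_degree[OF a(2)] assms(1) by linarith
    qed
    ultimately show ?thesis by blast
  next
    assume "involves_last g"
    then obtain a where a: "a \<in> Poly_Mapping.keys g" "0 < Poly_Mapping.lookup a None"
      by (auto simp: involves_last_def)
    let ?m = "expo a 0 + Poly_Mapping.single (Some None) 1"
    have "Poly_Mapping.lookup (emb f * w_var) ?m = 0"
      by (rule lookup_mult_MVar_zero) (simp add: lookup_add lookup_single)
    then have "Poly_Mapping.lookup (Phi f g) ?m = - Poly_Mapping.lookup g a"
      by (simp only: Phi_def lookup_minus lookup_mult_MVar lookup_emb) simp
    then have "?m \<in> Poly_Mapping.keys (Phi f g)" using a by (simp add: in_keys_iff)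
    moreover have "wt ?m \<le> int (d - 2)"
    proof -
      have "wt ?m = (\<Sum>i\<in>UNIV. int (Poly_Mapping.lookup a (Some i))) - 1"
        by (simp only: wt_add wt_expo) (simp add: wt_def lookup_single)
      moreover have "mdeg a = d" using a assms(3) by (simp add: form_def)
      ultimately show ?thesis using x_degree[OF a(2)] assms(1) by linarith
    qed
    ultimately show ?thesis by blast
  qed
qed

text \<open>A monomial of T is \<open>s\<^sup>i\<close> times the image of a monomial M, with
  \<open>i \<le> N\<close>; its product with \<open>\<Psi>\<close> is the image of
  \<open>M F\<^sub>i\<close>.\<close>

lemma lift_multiple:
  fixes F :: "nat \<Rightarrow> ('n::finite, 'k::field) Ry"
  assumes F: "\<And>i. i \<le> N \<Longrightarrow> sigma (F i) = s_var ^ i * \<Psi>"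
    and T: "\<And>m. m \<in> Poly_Mapping.keys T \<Longrightarrow> - int N \<le> wt m"
  shows "\<exists>G\<in>ideal_gen (F ` {0..N}). sigma G = \<Psi> * T"
proof -
  have "\<exists>G\<in>ideal_gen (F ` {0..N}). sigma G = \<Psi> * Poly_Mapping.single m (Poly_Mapping.lookup T m)"
    if m: "m \<in> Poly_Mapping.keys T" for m
  proof -
    obtain i a b where i: "i \<le> N"
      and eq: "(Poly_Mapping.single m 1 :: ('n, 'k) Rsw) = s_var ^ i * sigma (mon a b)"
      by (rule weight_monomial[OF T[OF m]])
    let ?c = "Poly_Mapping.lookup T m"
    let ?G = "MConst (MConst ?c) * mon a b * F i"
    have "?G \<in> ideal_gen (F ` {0..N})" using i by (intro ideal_gen_mult ideal_gen_base) simp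
    moreover have "sigma ?G = \<Psi> * (MConst ?c * (s_var ^ i * sigma (mon a b)))"
      using F[OF i] by (simp add: sigma.hom_mult mult_ac)
    then have "sigma ?G = \<Psi> * Poly_Mapping.single m ?c"
      unfolding eq[symmetric] by (simp add: MConst_def mult_single)
    ultimately show ?thesis by (rule bexI[rotated])
  qed
  then have "\<forall>m\<in>Poly_Mapping.keys T. \<exists>G. G \<in> ideal_gen (F ` {0..N}) \<and>
      sigma G = \<Psi> * Poly_Mapping.single m (Poly_Mapping.lookup T m)" by blast
  then obtain G where G: "\<forall>m\<in>Poly_Mapping.keys T. G m \<in> ideal_gen (F ` {0..N}) \<and>
      sigma (G m) = \<Psi> * Poly_Mapping.single m (Poly_Mapping.lookup T m)"
    by (rule bchoice[elim_format]) (elim exE, rule that)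
  have "sigma (sum G (Poly_Mapping.keys T)) =
      \<Psi> * (\<Sum>m\<in>Poly_Mapping.keys T. Poly_Mapping.single m (Poly_Mapping.lookup T m))"
    using G by (simp add: sigma.hom_sum sum_distrib_left)
  then have "sigma (sum G (Poly_Mapping.keys T)) = \<Psi> * T"
    using poly_mapping_eq_sum[of T] by simp
  moreover have "sum G (Poly_Mapping.keys T) \<in> ideal_gen (F ` {0..N})"
    using G by (intro ideal_gen_sum) simp
  ultimately show ?thesis by (rule bexI)
qed

lemma sigma_start_form:
  assumes "start_form d f g F0"
  shows "sigma F0 = Phi f g"
proof -
  obtain q where q: "g = (\<Sum>i\<in>UNIV. q i * MVar (Some i))"
    and F0: "F0 = MConst f * yvar None - (\<Sum>i\<in>UNIV. MConst (q i) * yvar (Some i))"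
    using assms unfolding start_form_def by blast
  show ?thesis
    unfolding F0 Phi_def q
    by (simp add: sigma.hom_simps emb.hom_simps sum_distrib_left sum_distrib_right mult_ac)
qed

text \<open>As \<open>\<sigma>(y\<^sub>j) = x\<^sub>j s\<close>, exchanging \<open>x\<^sub>j\<close>
  for \<open>y\<^sub>j\<close> multiplies the image by s, whichever decomposition of G was
  chosen.\<close>

lemma sigma_downgrade:
  assumes "downgrades_to d i G G'"
  shows "sigma G' = s_var * sigma G"
proof -
  obtain c where "G = (\<Sum>j\<in>UNIV. c j * xvar (Some j))" "G' = (\<Sum>j\<in>UNIV. c j * yvar (Some j))"
    using assms unfolding downgrades_to_def by blast
  then show ?thesis by (simp add: sigma.hom_simps sum_distrib_left mult_ac)
qed

lemma sigma_downgraded: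
  assumes "fully_downgraded_sequence d f g F" "i \<le> d - 2"
  shows "sigma (F i) = s_var ^ i * Phi f g"
  using assms(2)
proof (induction i)
  case 0
  have "start_form d f g (F 0)" using assms(1) by (simp add: fully_downgraded_sequence_def)
  then have "sigma (F 0) = Phi f g" by (rule sigma_start_form)
  then show ?case by simp
next
  case (Suc i)
  then have "i + 3 \<le> d" by linarith
  then have "downgrades_to d i (F i) (F (Suc i))"
    using assms(1) by (simp add: fully_downgraded_sequence_def)
  then have "sigma (F (Suc i)) = s_var * sigma (F i)" by (rule sigma_downgrade)
  then show ?case using Suc by simp
qed

lemma rees_hom_xvar_yvar:
  fixes f g :: "('n, 'k::field) R"
  shows "rees_hom (dJ_map f g) (yvar (Some j)) = Polynomial.monom f 1 * rees_hom (dJ_map f g) (xvar (Some j))"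
proof -
  interpret c: comm_ring_hom "\<lambda>c :: ('n, 'k) R. [:c:]" by (rule comm_ring_hom_const_poly)
  show ?thesis
    by (simp add: xvar_def yvar_def c.eval_hom_MConst c.eval_hom_MVar smult_monom mult.commute)
qed

text \<open>\<open>F\<^sub>0\<close> goes to
  \<open>(f g - \<Sum> q\<^sub>i x\<^sub>i f) t = 0\<close>, and each downgrading multiplies the
  image by \<open>f t\<close>, since \<open>y\<^sub>j\<close> goes to
  \<open>x\<^sub>j f t\<close>.\<close>

lemma rees_hom_downgraded:
  fixes F :: "nat \<Rightarrow> ('n::finite, 'k::field) Ry"
  assumes "fully_downgraded_sequence d f g F" "i \<le> d - 2"
  shows "rees_hom (dJ_map f g) (F i) = 0"
  using assms(2)
proof (induction i)
  case 0
  interpret c: comm_ring_hom "\<lambda>c :: ('n, 'k) R. [:c:]" by (rule comm_ring_hom_const_poly)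
  interpret r: comm_ring_hom "rees_hom (dJ_map f g)" by (rule comm_ring_hom_rees_hom)
  obtain q where q: "g = (\<Sum>i\<in>UNIV. q i * MVar (Some i))"
    and F0: "F 0 = MConst f * yvar None - (\<Sum>i\<in>UNIV. MConst (q i) * yvar (Some i))"
    using assms(1) unfolding start_form_def fully_downgraded_sequence_def by blast
  have "rees_hom (dJ_map f g) (F 0) =
      Polynomial.monom (f * g) 1 - (\<Sum>i\<in>UNIV. Polynomial.monom (q i * (MVar (Some i) * f)) 1)"
    unfolding F0
    by (simp add: r.hom_diff r.hom_mult r.hom_sum yvar_def c.eval_hom_MConst c.eval_hom_MVar smult_monom
        del: One_nat_def)
  also have "(\<Sum>i\<in>UNIV. Polynomial.monom (q i * (MVar (Some i) * f)) 1) = Polynomial.monom (f * g) 1"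
    unfolding q by (simp add: sum_distrib_left mult_ac flip: monom_sum)
  finally show ?case by simp
next
  case (Suc i)
  interpret r: comm_ring_hom "rees_hom (dJ_map f g)" by (rule comm_ring_hom_rees_hom)
  have "i + 3 \<le> d" using Suc.prems by linarith
  then have "downgrades_to d i (F i) (F (Suc i))"
    using assms(1) by (simp add: fully_downgraded_sequence_def)
  then obtain c where c: "F i = (\<Sum>j\<in>UNIV. c j * xvar (Some j))"
    "F (Suc i) = (\<Sum>j\<in>UNIV. c j * yvar (Some j))"
    unfolding downgrades_to_def by blast
  have "rees_hom (dJ_map f g) (F (Suc i)) = Polynomial.monom f 1 * rees_hom (dJ_map f g) (F i)"
    unfolding c by (simp only: r.hom_sum r.hom_mult rees_hom_xvar_yvar sum_distrib_left mult_ac)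
  then show ?case using Suc by simp
qed

lemma rees_hom_p_gen: "rees_hom (dJ_map f g) (p_gen i j) = 0"
proof -
  interpret r: comm_ring_hom "rees_hom (dJ_map f g)" by (rule comm_ring_hom_rees_hom)
  show ?thesis
    by (simp only: p_gen_def r.hom_diff r.hom_mult rees_hom_xvar_yvar mult_ac diff_self)
qed

lemma not_unit_form:
  fixes g :: "('v, 'k::field) mpoly"
  assumes "form d g" "0 < d"
  shows "\<not> g dvd 1"
proof
  assume "g dvd 1"
  then obtain h where h: "1 = g * h" by (rule dvdE)
  interpret z: comm_ring_hom "eval_hom (\<lambda>c::'k. c) (\<lambda>_ :: 'v. 0)"
    by (rule comm_ring_hom.comm_ring_hom_eval_hom[OF comm_ring_hom_id])
  \<comment> \<open>The value 0 is written as \<open>0 * 0\<close> to fit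
    \<open>eval_hom_scale\<close> with \<open>b = 0\<close>.\<close>
  have "eval_hom (\<lambda>c::'k. c) (\<lambda>_. 0 * 0) g = 0 ^ d * eval_hom (\<lambda>c. c) (\<lambda>_. 0) g"
    by (rule eval_hom_scale[OF assms(1)])
  then have "eval_hom (\<lambda>c::'k. c) (\<lambda>_. 0) g = 0" using assms(2) by (simp add: zero_power)
  then have "(1::'k) = 0" using arg_cong[OF h, of "eval_hom (\<lambda>c::'k. c) (\<lambda>_. 0)"]
    by (simp add: z.hom_one z.hom_mult)
  then show False by simp
qed

theorem rees_presentation_ideal_generated:
  fixes f g :: "('n::{finite, linorder}, 'k::field) R" and F :: "nat \<Rightarrow> ('n, 'k) Ry"
  assumes dJ: "gen_de_Jonquieres_id d f g" and F: "fully_downgraded_sequence d f g F"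
  shows "ideal_gen ({p_gen i j | i j. i < j} \<union> F ` {0..d - 2}) = rees_presentation_ideal (dJ_map f g)"
    (is "ideal_gen ?S = _")
proof (intro equalityI subsetI)
  fix P assume "P \<in> ideal_gen ?S"
  then have "rees_hom (dJ_map f g) P = 0"
    by (rule ideal_gen_subset_kernel[OF comm_ring_hom_rees_hom, rotated])
      (auto simp: rees_hom_p_gen rees_hom_downgraded[OF F] simp del: One_nat_def)
  then show "P \<in> rees_presentation_ideal (dJ_map f g)"
    by (simp add: rees_presentation_ideal_def)
next
  fix P assume "P \<in> rees_presentation_ideal (dJ_map f g)"
  then have P: "rees_hom (dJ_map f g) P = 0" by (simp add: rees_presentation_ideal_def)
  have d: "2 \<le> d" and forms: "form (d - 1) f" "form d g" and gcd: "gcd_is_one f g"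
    and last: "involves_last f \<or> involves_last g"
    using dJ by (simp_all add: gen_de_Jonquieres_id_def)
  have "f \<noteq> 0"
  proof
    assume "f = 0"
    then have "g dvd 1" using gcd by (simp add: gcd_is_one_def)
    then show False using not_unit_form[OF forms(2)] d by simp
  qed
  obtain m0 where m0: "m0 \<in> Poly_Mapping.keys (Phi f g)" "wt m0 \<le> int (d - 2)"
    using Phi_low_key[OF d forms last] by blast
  then have "Phi f g \<noteq> 0" by auto
  \<comment> \<open>Divisibility by \<open>Phi f g\<close> is available for forms in the
    \<open>y\<^sub>v\<close>, so P is treated degree by degree; each part is again a
    relation.\<close>
  have "degree_part e P \<in> ideal_gen ?S" for e
  proof -
    let ?Q = "degree_part e P"
    have "eval_hom (\<lambda>c. c) (dJ_map f g) ?Q = 0"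
      using P coeff_rees_hom[of "dJ_map f g" P e] by simp
    then have "Phi f g dvd sigma ?Q"
      by (rule Phi_dvd_sigma[OF gcd \<open>f \<noteq> 0\<close> \<open>Phi f g \<noteq> 0\<close> form_degree_part])
    then obtain T where T: "sigma ?Q = Phi f g * T" by (rule dvdE)
    have "- int (d - 2) \<le> wt m" if "m \<in> Poly_Mapping.keys T" for m
    proof -
      have "0 - wt m0 \<le> wt m"
      proof (rule weight_cofactor_ge[where p = "Phi f g" and q = T])
        show "0 \<le> wt m" if "m \<in> Poly_Mapping.keys (Phi f g * T)" for m
          using that unfolding T[symmetric] by (rule wt_sigma)
      qed (use m0 that in \<open>simp_all add: wt_add\<close>)
      then show ?thesis using m0(2) by linarith
    qed
    then obtain G where G: "G \<in> ideal_gen (F ` {0..d - 2})" "sigma G = Phi f g * T"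
      using lift_multiple[of "d - 2" F "Phi f g" T] sigma_downgraded[OF F] by blast
    have "sigma (?Q - G) = 0" using G(2) T by (simp add: sigma.hom_diff)
    then have "?Q - G \<in> p_ideal" by (rule sigma_kernel)
    then have "?Q - G \<in> ideal_gen ?S" using ideal_gen_mono[of "{p_gen i j | i j. i < j}" ?S] by blast
    moreover have "G \<in> ideal_gen ?S" using G(1) ideal_gen_mono[of "F ` {0..d - 2}" ?S] by blast
    ultimately have "(?Q - G) + G \<in> ideal_gen ?S" by (rule ideal_gen_add)
    then show ?thesis by simp
  qed
  then have "(\<Sum>e\<in>mdeg ` Poly_Mapping.keys P. degree_part e P) \<in> ideal_gen ?S"
    by (intro ideal_gen_sum)
  then show "P \<in> ideal_gen ?S" using sum_degree_part[of P] by simp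
qed

section \<open>Minimality of the generators\<close>

text \<open>
  Modulo \<open>sigma\<close>, an expression of \<open>F i\<close> by the other generators becomes an expression of
  \<open>s ^ i\<close> by other powers of \<open>s\<close>; setting all other variables to \<open>0\<close> makes its coefficients constant.
\<close>

definition s_spec :: "('n, 'k::field) Rsw \<Rightarrow> 'k poly" where
  "s_spec = eval_hom (\<lambda>c. [:c:]) (\<lambda>u. if u = Some None then [:0, 1:] else 0)"

interpretation const_poly: comm_ring_hom "\<lambda>c :: 'a::comm_ring_1. [:c:]"
  by (rule comm_ring_hom_const_poly)

interpretation s_spec: comm_ring_hom "s_spec :: ('n, 'k::field) Rsw \<Rightarrow> 'k poly"
  unfolding s_spec_def by (rule const_poly.comm_ring_hom_eval_hom)

lemma s_spec_simps [simp]: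
  "s_spec (MConst c) = [:c:]" "s_spec (MVar u) = (if u = Some None then [:0, 1:] else 0)"
  by (simp_all add: s_spec_def const_poly.eval_hom_MConst const_poly.eval_hom_MVar)

lemma degree_0_add: "degree p = 0 \<Longrightarrow> degree q = 0 \<Longrightarrow> degree (p + q) = 0"
  using degree_add_le[of p 0 q] by simp

lemma degree_0_mult: "degree p = 0 \<Longrightarrow> degree q = 0 \<Longrightarrow> degree (p * q) = 0"
  using degree_mult_le[of p q] by simp

lemma s_spec_emb: "degree (s_spec (emb p)) = 0"
  by (induction p rule: mpoly_induct)
    (simp_all add: emb.hom_simps s_spec.hom_simps degree_0_add degree_0_mult)

text \<open>In the image of \<open>sigma\<close>, s enters together with some
  \<open>x\<^sub>i\<close>, which is sent to 0.\<close>

lemma s_spec_sigma: "degree (s_spec (sigma P)) = 0" for P :: "('n, 'k::field) Ry"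
proof (induction P rule: mpoly_induct)
  case (const c) then show ?case by (simp add: s_spec_emb)
next
  case (var v)
  have "sigma (MVar v :: ('n, 'k) Ry) = sigma_var v" using sigma_simps(3)[of v] by (simp add: yvar_def)
  then show ?case by (cases v) (simp_all add: s_spec.hom_simps)
qed (simp_all add: sigma.hom_simps s_spec.hom_simps degree_0_add degree_0_mult)

lemma F_not_redundant:
  fixes F :: "nat \<Rightarrow> ('n::{finite, linorder}, 'k::field) Ry"
  assumes F: "\<And>i. i \<le> N \<Longrightarrow> sigma (F i) = s_var ^ i * \<Psi>" and "\<Psi> \<noteq> 0" "i \<le> N"
  shows "F i \<notin> ideal_gen ({p_gen i j | i j. i < j} \<union> F ` ({0..N} - {i}))"
proof
  assume *: "F i \<in> ideal_gen ({p_gen i j | i j. i < j} \<union> F ` ({0..N} - {i}))"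
  have "finite ({0..N} - {i})" by simp
  from ideal_gen_Un_image[OF this *]
  obtain A where A: "F i - (\<Sum>j\<in>{0..N} - {i}. A j * F j) \<in> p_ideal" ..
  have "sigma (F i - (\<Sum>j\<in>{0..N} - {i}. A j * F j)) = 0"
    by (rule ideal_gen_subset_kernel[OF sigma.comm_ring_hom_axioms _ A]) (auto simp: sigma_p_gen)
  moreover have "(\<Sum>j\<in>{0..N} - {i}. sigma (A j) * sigma (F j)) =
      (\<Sum>j\<in>{0..N} - {i}. sigma (A j) * s_var ^ j) * \<Psi>"
    unfolding sum_distrib_right using F by (intro sum.cong) (simp_all add: mult.assoc)
  ultimately have "s_var ^ i * \<Psi> = (\<Sum>j\<in>{0..N} - {i}. sigma (A j) * s_var ^ j) * \<Psi>"
    using F[OF \<open>i \<le> N\<close>] by (simp add: sigma.hom_simps)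
  then have "s_var ^ i = (\<Sum>j\<in>{0..N} - {i}. sigma (A j) * s_var ^ j)"
    using \<open>\<Psi> \<noteq> 0\<close> by simp
  then have "s_spec (s_var ^ i :: ('n, 'k) Rsw) = s_spec (\<Sum>j\<in>{0..N} - {i}. sigma (A j) * s_var ^ j)"
    by (rule arg_cong)
  then have "[:0, 1:] ^ i = (\<Sum>j\<in>{0..N} - {i}. s_spec (sigma (A j)) * [:0, 1:] ^ j)"
    by (simp add: s_spec.hom_simps)
  then have "coeff ([:0, 1:] ^ i) i = (\<Sum>j\<in>{0..N} - {i}. coeff (s_spec (sigma (A j)) * [:0, 1:] ^ j) i)"
    by (simp add: coeff_sum)
  also have "\<dots> = 0"
  proof (rule sum.neutral, rule ballI)
    fix j assume j: "j \<in> {0..N} - {i}"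
    obtain c where "s_spec (sigma (A j)) = [:c:]" using s_spec_sigma by (blast elim: degree_eq_zeroE)
    moreover have "[:0, 1:] ^ j = Polynomial.monom (1::'k) j" by (simp add: monom_altdef)
    ultimately show "coeff (s_spec (sigma (A j)) * [:0, 1:] ^ j) i = 0" using j by simp
  qed
  finally have "coeff (Polynomial.monom (1::'k) i) i = 0" by (simp add: monom_altdef)
  then show False by simp
qed

text \<open>
  The specialization \<open>x\<^sub>j \<mapsto> a\<close>, \<open>y\<^sub>i \<mapsto> b\<close>, with all other variables sent to \<open>0\<close>, into \<open>k[a][b]\<close>:
  of all the \<open>p_gen\<close>'s only \<open>p_gen i j\<close> survives.
\<close>

definition ab_spec_x :: "'n \<Rightarrow> ('n, 'k::field) R \<Rightarrow> 'k poly poly" where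
  "ab_spec_x j = eval_hom (\<lambda>c. [:[:c:]:]) (\<lambda>v. if v = Some j then [:[:0, 1:]:] else 0)"

definition ab_spec :: "'n \<Rightarrow> 'n \<Rightarrow> ('n, 'k::field) Ry \<Rightarrow> 'k poly poly" where
  "ab_spec i j = eval_hom (ab_spec_x j) (\<lambda>v. if v = Some i then [:0, 1:] else 0)"

lemma const_const_hom: "comm_ring_hom (\<lambda>c :: 'k::field. [:[:c:]:])"
  by (rule comm_ring_hom_compose[OF comm_ring_hom_const_poly comm_ring_hom_const_poly])

interpretation const_const: comm_ring_hom "\<lambda>c :: 'k::field. [:[:c:]:]"
  by (rule const_const_hom)

interpretation ab_spec_x: comm_ring_hom "ab_spec_x j :: ('n, 'k::field) R \<Rightarrow> 'k poly poly" for j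
  unfolding ab_spec_x_def by (rule const_const.comm_ring_hom_eval_hom)

interpretation ab_spec: comm_ring_hom "ab_spec i j :: ('n, 'k::field) Ry \<Rightarrow> 'k poly poly" for i j
  unfolding ab_spec_def by (rule ab_spec_x.comm_ring_hom_eval_hom)

lemma ab_spec_x_simps [simp]:
  "ab_spec_x j (MConst c) = [:[:c:]:]"
  "ab_spec_x j (MVar v) = (if v = Some j then [:[:0, 1:]:] else 0)"
  by (simp_all add: ab_spec_x_def const_const.eval_hom_MConst const_const.eval_hom_MVar)

lemma ab_spec_simps [simp]:
  "ab_spec i j (MConst p) = ab_spec_x j p"
  "ab_spec i j (xvar v) = (if v = Some j then [:[:0, 1:]:] else 0)"
  "ab_spec i j (yvar v) = (if v = Some i then [:0, 1:] else 0)"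
  by (simp_all add: ab_spec_def xvar_def yvar_def ab_spec_x.eval_hom_MConst ab_spec_x.eval_hom_MVar)

lemma ab_spec_form:
  assumes "form e P"
  shows "[:0, 1:] ^ e dvd ab_spec i j P"
proof -
  have eq: "(\<lambda>v. if v = Some i then [:0, 1:] else 0) =
      (\<lambda>v. [:0, 1:] * (if v = Some i then 1 else 0 :: 'b poly poly))" by auto
  have "ab_spec i j P = [:0, 1:] ^ e * eval_hom (ab_spec_x j) (\<lambda>v. if v = Some i then 1 else 0) P"
    unfolding ab_spec_def eq by (rule eval_hom_scale[OF assms])
  then show ?thesis by simp
qed

lemma ab_spec_x_form:
  assumes "form e p"
  shows "[:[:0, 1:]:] ^ e dvd ab_spec_x j p"
proof -
  have eq: "(\<lambda>v. if v = Some j then [:[:0, 1:]:] else 0) =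
      (\<lambda>v. [:[:0, 1:]:] * (if v = Some j then 1 else 0 :: 'b poly poly))" by auto
  have "ab_spec_x j p = [:[:0, 1:]:] ^ e * eval_hom (\<lambda>c. [:[:c:]:]) (\<lambda>v. if v = Some j then 1 else 0) p"
    unfolding ab_spec_x_def eq by (rule eval_hom_scale[OF assms])
  then show ?thesis by simp
qed

text \<open>The coefficient of \<open>y\<^sub>i\<close> already has positive degree in the
  \<open>y\<^sub>v\<close>, so b divides the result twice. Among the \<open>F\<^sub>l\<close>, this
  leaves \<open>F\<^sub>0\<close> alone to contribute to the part linear in b.\<close>

lemma ab_spec_downgrade:
  fixes G G' :: "('n::finite, 'k::field) Ry"
  assumes "downgrades_to d l G G'"
  shows "[:0, 1:] ^ 2 dvd ab_spec i j G'"
proof -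
  obtain c where c: "\<forall>j. bihomogeneous (d - 2 - l) (l + 1) (c j) \<and> c j \<in> ideal_pow mRy (d - 3 - l)"
    and G': "G' = (\<Sum>j\<in>UNIV. c j * yvar (Some j))"
    using assms unfolding downgrades_to_def by (elim exE conjE) (rule that)
  have "form (l + 1) (c i)" using c by (simp add: bihomogeneous_def)
  then have "[:0, 1:] ^ (l + 1) dvd ab_spec i j (c i)" by (rule ab_spec_form)
  then obtain z where z: "ab_spec i j (c i) = [:0, 1:] ^ (l + 1) * z" by (rule dvdE)
  have "ab_spec i j G' = (\<Sum>m\<in>UNIV. if m = i then ab_spec i j (c i) * [:0, 1:] else 0)"
    unfolding G' ab_spec.hom_sum by (intro sum.cong) (auto simp: ab_spec.hom_mult)
  then have "ab_spec i j G' = ab_spec i j (c i) * [:0, 1:]" by simp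
  moreover have "b ^ (l + 1) * z * b = b ^ 2 * (b ^ l * z)" for b :: "'k poly poly"
    by (simp add: power2_eq_square mult_ac)
  ultimately show ?thesis unfolding z by (simp only: dvd_triv_left)
qed

lemma ab_spec_start:
  fixes F0 :: "('n::finite, 'k::field) Ry"
  assumes "start_form d f g F0"
  shows "\<exists>q. form (d - 1) q \<and> ab_spec i j F0 = - (ab_spec_x j q * [:0, 1:])"
proof -
  obtain q where q: "\<forall>i. form (d - 1) (q i) \<and> monoid_poly (q i)"
    and F0: "F0 = MConst f * yvar None - (\<Sum>i\<in>UNIV. MConst (q i) * yvar (Some i))"
    using assms unfolding start_form_def by (elim exE conjE) (rule that)
  have "ab_spec i j (\<Sum>m\<in>UNIV. MConst (q m) * yvar (Some m)) =
      (\<Sum>m\<in>UNIV. if m = i then ab_spec_x j (q i) * [:0, 1:] else 0)"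
    unfolding ab_spec.hom_sum by (intro sum.cong) (auto simp: ab_spec.hom_mult)
  then have "ab_spec i j F0 = - (ab_spec_x j (q i) * [:0, 1:])"
    unfolding F0 by (simp add: ab_spec.hom_diff ab_spec.hom_mult)
  then show ?thesis using q by (intro exI[of _ "q i"] conjI) simp_all
qed

definition origin :: "('n, 'k::field) Rsw \<Rightarrow> 'k" where
  "origin = eval_hom (\<lambda>c. c) (\<lambda>_. 0)"

interpretation origin: comm_ring_hom "origin :: ('n, 'k::field) Rsw \<Rightarrow> 'k"
  unfolding origin_def by (rule comm_ring_hom.comm_ring_hom_eval_hom[OF comm_ring_hom_id])

lemma origin_simps [simp]: "origin (MConst c) = c" "origin (MVar u) = 0"
  by (simp_all add: origin_def comm_ring_hom.eval_hom_MConst[OF comm_ring_hom_id]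
      comm_ring_hom.eval_hom_MVar[OF comm_ring_hom_id])

lemma origin_emb: "poly (poly (ab_spec_x j p) 0) 0 = origin (emb p)"
  by (induction p rule: mpoly_induct) (simp_all add: emb.hom_simps origin.hom_simps ab_spec_x.hom_simps)

text \<open>Both sides pick out the constant term. This transfers what \<open>sigma\<close> reveals
  about a coefficient to its value under \<open>ab_spec\<close>.\<close>

lemma origin_sigma: "poly (poly (ab_spec i j P) 0) 0 = origin (sigma P)" for P :: "('n, 'k::field) Ry"
proof (induction P rule: mpoly_induct)
  case (const c) then show ?case by (simp add: origin_emb)
next
  case (var v)
  have "sigma (MVar v :: ('n, 'k) Ry) = sigma_var v" using sigma_simps(3)[of v] by (simp add: yvar_def)
  moreover have "ab_spec i j (MVar v :: ('n, 'k) Ry) = (if v = Some i then [:0, 1:] else 0)"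
    using ab_spec_simps(3)[of i j v] by (simp add: yvar_def)
  ultimately show ?case by (cases v) (simp_all add: origin.hom_mult)
qed (simp_all add: sigma.hom_simps origin.hom_simps ab_spec.hom_simps)

text \<open>Two images of one dependence are compared. Under \<open>sigma\<close>, division by
  \<open>\<Phi>\<close> leaves \<open>\<Sum> \<sigma>(A\<^sub>l) s\<^sup>l = 0\<close>, and at the
  origin this says that \<open>A\<^sub>0\<close> has constant term 0. Under \<open>ab_spec\<close>
  the dependence reads \<open>a b = \<Sum> A\<^sub>l F\<^sub>l\<close>, whose part linear in b comes
  from \<open>A\<^sub>0 F\<^sub>0\<close>; there \<open>F\<^sub>0\<close> is a multiple of
  \<open>a b\<close>, because \<open>d - 1 > 0\<close>. The coefficient of \<open>a b\<close> then
  exhibits 1 as a multiple of the constant term of \<open>A\<^sub>0\<close>.\<close>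

lemma p_gen_not_redundant:
  fixes F :: "nat \<Rightarrow> ('n::{finite, linorder}, 'k::field) Ry"
  assumes d: "2 \<le> d" and F: "fully_downgraded_sequence d f g F" and Phi: "Phi f g \<noteq> 0" and "i < j"
    and X: "X \<subseteq> {p_gen k l | k l. k < l} - {p_gen i j}"
  shows "p_gen i j \<notin> ideal_gen (X \<union> F ` {0..d - 2})"
proof
  assume "p_gen i j \<in> ideal_gen (X \<union> F ` {0..d - 2})"
  from ideal_gen_Un_image[OF finite_atLeastAtMost this]
  obtain A where A: "p_gen i j - (\<Sum>l\<in>{0..d - 2}. A l * F l) \<in> ideal_gen X" ..
  have "sigma (p_gen i j - (\<Sum>l\<in>{0..d - 2}. A l * F l)) = 0"
  proof (rule ideal_gen_subset_kernel[OF sigma.comm_ring_hom_axioms _ A])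
    fix a assume "a \<in> X"
    then obtain k l where "a = p_gen k l" using X by blast
    then show "sigma a = 0" by (simp add: sigma_p_gen)
  qed
  moreover have "(\<Sum>l\<in>{0..d - 2}. sigma (A l) * sigma (F l)) =
      (\<Sum>l\<in>{0..d - 2}. sigma (A l) * s_var ^ l) * Phi f g"
    unfolding sum_distrib_right
    by (intro sum.cong) (simp_all add: sigma_downgraded[OF F] mult.assoc)
  ultimately have "(\<Sum>l\<in>{0..d - 2}. sigma (A l) * s_var ^ l) * Phi f g = 0"
    by (simp add: sigma.hom_simps sigma_p_gen)
  then have "(\<Sum>l\<in>{0..d - 2}. sigma (A l) * s_var ^ l) = 0" using Phi by simp
  then have "0 = origin (\<Sum>l\<in>{0..d - 2}. sigma (A l) * s_var ^ l)" by (simp only: origin.hom_zero)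
  also have "\<dots> = (\<Sum>l\<in>{0..d - 2}. if l = 0 then origin (sigma (A 0)) else 0)"
    unfolding origin.hom_sum
    by (intro sum.cong) (auto simp: origin.hom_mult origin.hom_power power_0_left)
  finally have A0: "poly (poly (ab_spec i j (A 0)) 0) 0 = 0" by (simp add: origin_sigma)
  have "ab_spec i j (p_gen i j - (\<Sum>l\<in>{0..d - 2}. A l * F l)) = 0"
  proof (rule ideal_gen_subset_kernel[OF ab_spec.comm_ring_hom_axioms _ A])
    fix a assume "a \<in> X"
    then obtain k l where "a = p_gen k l" "k < l" "p_gen k l \<noteq> (p_gen i j :: ('n, 'k) Ry)"
      using X by blast
    \<comment> \<open>A term of \<open>p_gen k l\<close> survives only if k and l are i and j in
      some order, and the two inequalities then force \<open>k = i\<close> and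
      \<open>l = j\<close>.\<close>
    then show "ab_spec i j a = 0" using \<open>i < j\<close>
      by (auto simp: p_gen_def ab_spec.hom_simps)
  qed
  \<comment> \<open>Here b is the outer variable \<open>[:0, 1:]\<close> and a the inner one
    \<open>[:[:0, 1:]:]\<close>, so the value is \<open>a b\<close>.\<close>
  moreover have "ab_spec i j (p_gen i j :: ('n, 'k) Ry) = [:0, [:0, 1:]:]"
    using \<open>i < j\<close> by (auto simp: p_gen_def ab_spec.hom_simps)
  ultimately have eq: "[:0, [:0, 1:]:] = (\<Sum>l\<in>{0..d - 2}. ab_spec i j (A l) * ab_spec i j (F l))"
    by (simp add: ab_spec.hom_simps)
  have "coeff (ab_spec i j (A l) * ab_spec i j (F l)) 1 = 0" if l: "l \<in> {1..d - 2}" for l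
  proof -
    obtain l' where l': "l = Suc l'" using l by (cases l) auto
    then have "l' + 3 \<le> d" using l by auto
    then have "downgrades_to d l' (F l') (F l)"
      using F l' by (simp add: fully_downgraded_sequence_def)
    then have "[:0, 1:] ^ 2 dvd ab_spec i j (F l)" by (rule ab_spec_downgrade)
    then obtain z where "ab_spec i j (F l) = [:0, 1:] ^ 2 * z" by (rule dvdE)
    moreover have "x * (b ^ 2 * z) = b * (b * (x * z))" for x b :: "'k poly poly"
      by (simp add: power2_eq_square mult_ac)
    ultimately have "ab_spec i j (A l) * ab_spec i j (F l) = [:0, 1:] * ([:0, 1:] * (ab_spec i j (A l) * z))"
      by (simp only:)
    then show ?thesis by simp
  qed
  then have "coeff (\<Sum>l\<in>{1..d - 2}. ab_spec i j (A l) * ab_spec i j (F l)) 1 = 0"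
    by (simp add: coeff_sum)
  moreover have "{0..d - 2} = insert 0 {1..d - 2}" by auto
  ultimately have c1: "coeff [:0, [:0, 1:]:] 1 = coeff (ab_spec i j (A 0) * ab_spec i j (F 0)) 1"
    unfolding eq by simp
  have "start_form d f g (F 0)" using F by (simp add: fully_downgraded_sequence_def)
  from ab_spec_start[OF this, of i j]
  obtain q where q: "form (d - 1) q" "ab_spec i j (F 0) = - (ab_spec_x j q * [:0, 1:])"
    by (elim exE conjE) (rule that)
  have "[:[:0, 1 :: 'k:]:] dvd [:[:0, 1:]:] ^ (d - 1)" using d by (intro dvd_power) simp
  then have "[:[:0, 1:]:] dvd ab_spec_x j q" using ab_spec_x_form[OF q(1)] by (rule dvd_trans)
  then obtain z where z: "ab_spec_x j q = [:[:0, 1:]:] * z" by (rule dvdE)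
  have "x * (- ((a * z) * b)) = b * (- (x * z * a))" for x a b :: "'k poly poly"
    by (simp add: mult_ac)
  then have A0F0: "ab_spec i j (A 0) * ab_spec i j (F 0) = [:0, 1:] * (- (ab_spec i j (A 0) * z * [:[:0, 1:]:]))"
    unfolding q(2) z .
  have "coeff ([:0, 1:] * Y) 1 = coeff Y 0" for Y :: "'k poly poly" by simp
  moreover have "[:0, 1:] = coeff [:0, [:0, 1 :: 'k:]:] 1" by simp
  ultimately have "[:0, 1:] = coeff (- (ab_spec i j (A 0) * z * [:[:0, 1:]:])) 0"
    using c1 unfolding A0F0 by (simp only:)
  also have "\<dots> = - (coeff (ab_spec i j (A 0)) 0 * coeff z 0 * [:0, 1:])"
    by (simp add: coeff_mult)
  finally have "coeff [:0, 1 :: 'k:] 1 = coeff (- (coeff (ab_spec i j (A 0)) 0 * coeff z 0 * [:0, 1:])) 1"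
    by (rule arg_cong)
  also have "\<dots> = - (coeff (coeff (ab_spec i j (A 0)) 0) 0 * coeff (coeff z 0) 0)"
    by (simp add: coeff_mult)
  also have "\<dots> = 0" using A0 by (simp add: poly_0_coeff_0)
  finally show False by simp
qed

theorem theorem2p6:
  fixes f g :: "('n::{finite, linorder}, 'k::field) R"
    and F :: "nat \<Rightarrow> ('n, 'k) Ry"
    and d :: nat
  assumes "infinite (UNIV :: 'k set)"
    and "card (UNIV :: 'n set) \<ge> 2"
    and "gen_de_Jonquieres_id d f g"
    and "fully_downgraded_sequence d f g F"
  shows "minimal_generating_set (rees_presentation_ideal (dJ_map f g))
           ({p_gen i j | i j. i < j} \<union> F ` {0..d - 2})"
proof -
  let ?X = "{p_gen i j | i j. i < j} :: ('n, 'k) Ry set"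
  let ?S = "?X \<union> F ` {0..d - 2}"
  note F = assms(4)
  have gen: "ideal_gen ?S = rees_presentation_ideal (dJ_map f g)"
    using assms(3) F by (rule rees_presentation_ideal_generated)
  have d: "2 \<le> d" using assms(3) by (simp add: gen_de_Jonquieres_id_def)
  have "\<exists>m\<in>Poly_Mapping.keys (Phi f g). wt m \<le> int (d - 2)"
    by (rule Phi_low_key) (use assms(3) in \<open>simp_all add: gen_de_Jonquieres_id_def\<close>)
  then have Phi: "Phi f g \<noteq> 0" by auto
  have "a \<notin> ideal_gen (?S - {a})" if "a \<in> ?S" for a
    using that
  proof
    assume "a \<in> ?X"
    then obtain i j where a: "a = p_gen i j" "i < j" by blast
    have "a \<notin> ideal_gen ((?X - {a}) \<union> F ` {0..d - 2})"
      unfolding a(1) by (rule p_gen_not_redundant[OF d F Phi a(2)]) blast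
    \<comment> \<open>Only an inclusion, since a priori the value a might also occur among the
      \<open>F i\<close>.\<close>
    moreover have "?S - {a} \<subseteq> (?X - {a}) \<union> F ` {0..d - 2}" by auto
    ultimately show ?thesis using ideal_gen_mono by (meson subsetD)
  next
    assume "a \<in> F ` {0..d - 2}"
    then obtain i where a: "a = F i" "i \<le> d - 2" by auto
    have "F i \<notin> ideal_gen (?X \<union> F ` ({0..d - 2} - {i}))"
      by (rule F_not_redundant[OF sigma_downgraded[OF F] Phi a(2)])
    moreover have "?S - {F i} \<subseteq> ?X \<union> F ` ({0..d - 2} - {i})" by auto
    ultimately show ?thesis unfolding a(1) using ideal_gen_mono by (meson subsetD)
  qed
  then show ?thesis using gen by (intro minimal_generating_setI)
qed

end
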